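(* Let $n\ge 1$. For any reductive group $G\subset O(n)$, the invariant vertex algebra $\mathcal{H}(n)^G$ is finitely generated as a vertex algebra.
   Context: Everything is over $\mathbb{C}$. $\mathcal{H}(n)$ is the rank $n$ Heisenberg vertex algebra, generated by fields $\alpha^1,\dots,\alpha^n$ with OPE $\alpha^i(z)\alpha^j(w)\sim\delta_{i,j}(z-w)^{-2}$. The complex orthogonal group $O(n)$ acts on $\mathcal{H}(n)$ by vertex algebra automorphisms, through its standard linear action on the span of the orthonormal vectors $\alpha^1,\dots,\alpha^n$; $\mathcal{H}(n)^G$ is the subalgebra of $G$-invariants. A vertex algebra $\mathcal{A}$ is finitely generated if there is a finite subset $S$ such that every element of $\mathcal{A}$ is a linear combination of nonassociative words in elements of $S$ and the products $\circ_k$, $k\in\mathbb{Z}$, where $a\circ_k b=a(k)b$ is the $k$th product (words with no letters giving the vacuum $1$). *)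

theory Defs
  imports
    "HOL-Analysis.Analysis"
    "Jordan_Normal_Form.Matrix"
begin

text \<open>\<^theory>\<open>HOL-Analysis.Finite_Cartesian_Product\<close> and
  \<^theory>\<open>Jordan_Normal_Form.Matrix\<close> both use \<open>$\<close> and \<open>vec\<close>. Here \<open>$\<close> is the former's; elements of
  a group of \<open>n \<times> n\<close> matrices have type \<open>complex ^ 'n ^ 'n\<close>. The latter's matrices are used for the
  representation spaces, whose dimension has to be quantified.\<close>

no_notation vec_index (infixl "$" 100)

section \<open>Vertex algebras\<close>

text \<open>\<open>prd k a b\<close> is the product \<open>a \<circ>\<^sub>k b = a(k) b\<close>, the coefficient of \<open>z\<close> to the power \<open>-k-1\<close> in
  \<open>a(z) b\<close>. The sums in the Borcherds identity have only finitely many nonzero terms by truncation, so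
  they are the eventual values of their partial sums.\<close>

locale vertex_algebra = vector_space scale
  for scale :: "complex \<Rightarrow> 'v::ab_group_add \<Rightarrow> 'v" +
  fixes vac :: 'v
    and prd :: "int \<Rightarrow> 'v \<Rightarrow> 'v \<Rightarrow> 'v"
  assumes prd_linear_left: "Vector_Spaces.linear scale scale (\<lambda>a. prd k a b)"
    and prd_linear_right: "Vector_Spaces.linear scale scale (prd k a)"
    and truncation: "\<exists>N. \<forall>k\<ge>N. prd k a b = 0"
    and vacuum: "prd k vac b = (if k = - 1 then b else 0)"
    and creation: "prd (- 1) a vac = a"
    and creation_nonneg: "k \<ge> 0 \<Longrightarrow> prd k a vac = 0"
    and borcherds:
      "\<forall>\<^sub>F N in sequentially.
         (\<Sum>j<N. scale (of_int m gchoose j) (prd (m + k - int j) (prd (n + int j) a b) c)) =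
         (\<Sum>j<N. scale ((- 1) ^ j * (of_int n gchoose j))
            (prd (m + n - int j) a (prd (k + int j) b c)
             - scale ((- 1) powi n) (prd (n + k - int j) b (prd (m + int j) a c))))"
begin

inductive_set words :: "'v set \<Rightarrow> 'v set" for S :: "'v set" where
  empty: "vac \<in> words S"
| letter: "s \<in> S \<Longrightarrow> s \<in> words S"
| product: "a \<in> words S \<Longrightarrow> b \<in> words S \<Longrightarrow> prd k a b \<in> words S"

text \<open>\<open>span (words S)\<close> is the vertex subalgebra generated by \<open>S\<close>, so the following predicate can only
  hold of vertex subalgebras.\<close>

definition finitely_generated :: "'v set \<Rightarrow> bool" where
  "finitely_generated A \<longleftrightarrow> (\<exists>S. finite S \<and> S \<subseteq> A \<and> A = span (words S))"

definition automorphism :: "('v \<Rightarrow> 'v) \<Rightarrow> bool" where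
  "automorphism \<phi> \<longleftrightarrow> Vector_Spaces.linear scale scale \<phi> \<and> bij \<phi> \<and> \<phi> vac = vac \<and>
     (\<forall>k a b. \<phi> (prd k a b) = prd k (\<phi> a) (\<phi> b))"

end


section \<open>The Heisenberg vertex algebra of rank \<open>CARD('n)\<close>\<close>

text \<open>The generating fields and their OPE determine the vertex algebra up to isomorphism as soon as it
  is nonzero: it is a nonzero quotient of the irreducible Fock module with \<open>\<alpha>\<^sup>i(0) = 0\<close>. The pole of
  order \<open>k + 1\<close> of \<open>\<alpha>\<^sup>i(z) \<alpha>\<^sup>j(w)\<close> at \<open>z = w\<close> has coefficient \<open>\<alpha>\<^sup>i \<circ>\<^sub>k \<alpha>\<^sup>j\<close>, for \<open>k \<ge> 0\<close>.\<close>

locale heisenberg_vertex_algebra = vertex_algebra scale vac prd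
  for scale :: "complex \<Rightarrow> 'v::ab_group_add \<Rightarrow> 'v"
    and vac :: 'v
    and prd :: "int \<Rightarrow> 'v \<Rightarrow> 'v \<Rightarrow> 'v" +
  fixes \<alpha> :: "'n::finite \<Rightarrow> 'v"
  assumes vac_nonzero: "vac \<noteq> 0"
    and ope: "k \<ge> 0 \<Longrightarrow> prd k (\<alpha> i) (\<alpha> j) = (if k = 1 \<and> i = j then vac else 0)"
    and generated: "span (words (range \<alpha>)) = UNIV"

definition orthogonal_group :: "(complex ^ 'n ^ 'n) set" where
  "orthogonal_group = {g. orthogonal_matrix g}"

text \<open>The action of \<open>O(n)\<close> by automorphisms extending \<open>g \<alpha>\<^sup>i = \<Sum>\<^sub>j g\<^sub>j\<^sub>i \<alpha>\<^sup>j\<close>. The values of \<open>\<rho>\<close> on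
  \<open>O(n)\<close> are determined by this, because the \<open>\<alpha>\<^sup>i\<close> generate.\<close>

definition (in heisenberg_vertex_algebra) standard_action ::
    "(complex ^ 'n ^ 'n \<Rightarrow> 'v \<Rightarrow> 'v) \<Rightarrow> bool" where
  "standard_action \<rho> \<longleftrightarrow>
     (\<forall>g\<in>orthogonal_group. automorphism (\<rho> g) \<and>
        (\<forall>i. \<rho> g (\<alpha> i) = (\<Sum>j\<in>UNIV. scale (g $ j $ i) (\<alpha> j)))) \<and>
     \<rho> (Finite_Cartesian_Product.mat 1) = id \<and>
     (\<forall>g\<in>orthogonal_group. \<forall>h\<in>orthogonal_group. \<rho> (g ** h) = \<rho> g \<circ> \<rho> h)"

definition invariants :: "('g \<Rightarrow> 'v \<Rightarrow> 'v) \<Rightarrow> 'g set \<Rightarrow> 'v set" where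
  "invariants \<rho> G = {v. \<forall>g\<in>G. \<rho> g v = v}"


section \<open>Reductive groups\<close>

inductive polynomial_on_matrices :: "(complex ^ 'n ^ 'n \<Rightarrow> complex) \<Rightarrow> bool" where
  const: "polynomial_on_matrices (\<lambda>g. c)"
| entry: "polynomial_on_matrices (\<lambda>g. g $ i $ j)"
| add: "polynomial_on_matrices p \<Longrightarrow> polynomial_on_matrices q \<Longrightarrow> polynomial_on_matrices (\<lambda>g. p g + q g)"
| mult: "polynomial_on_matrices p \<Longrightarrow> polynomial_on_matrices q \<Longrightarrow> polynomial_on_matrices (\<lambda>g. p g * q g)"

text \<open>Zariski closed subgroups of the general linear group.\<close>

definition linear_algebraic_group :: "(complex ^ 'n ^ 'n) set \<Rightarrow> bool" where
  "linear_algebraic_group G \<longleftrightarrow>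
     Finite_Cartesian_Product.mat 1 \<in> G \<and>
     (\<forall>g\<in>G. \<forall>h\<in>G. g ** h \<in> G) \<and>
     (\<forall>g\<in>G. matrix_inv g \<in> G) \<and>
     (\<exists>P. (\<forall>p\<in>P. polynomial_on_matrices p) \<and> G = {g. invertible g \<and> (\<forall>p\<in>P. p g = 0)})"

definition regular_function_on :: "(complex ^ 'n ^ 'n) set \<Rightarrow> (complex ^ 'n ^ 'n \<Rightarrow> complex) \<Rightarrow> bool" where
  "regular_function_on G f \<longleftrightarrow>
     (\<exists>p r. polynomial_on_matrices p \<and> (\<forall>g\<in>G. f g = p g / det g ^ r))"

definition rational_representation ::
    "(complex ^ 'n ^ 'n) set \<Rightarrow> nat \<Rightarrow> (complex ^ 'n ^ 'n \<Rightarrow> complex Matrix.mat) \<Rightarrow> bool" where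
  "rational_representation G d \<pi> \<longleftrightarrow>
     (\<forall>g\<in>G. \<pi> g \<in> carrier_mat d d) \<and>
     \<pi> (Finite_Cartesian_Product.mat 1) = 1\<^sub>m d \<and>
     (\<forall>g\<in>G. \<forall>h\<in>G. \<pi> (g ** h) = \<pi> g * \<pi> h) \<and>
     (\<forall>i<d. \<forall>j<d. regular_function_on G (\<lambda>g. \<pi> g $$ (i, j)))"

definition invariant_subspace ::
    "'g set \<Rightarrow> nat \<Rightarrow> ('g \<Rightarrow> complex Matrix.mat) \<Rightarrow> complex Matrix.vec set \<Rightarrow> bool" where
  "invariant_subspace G d \<pi> W \<longleftrightarrow>
     W \<subseteq> carrier_vec d \<and> 0\<^sub>v d \<in> W \<and>
     (\<forall>v\<in>W. \<forall>w\<in>W. v + w \<in> W) \<and> (\<forall>c. \<forall>w\<in>W. c \<cdot>\<^sub>v w \<in> W) \<and>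
     (\<forall>g\<in>G. \<forall>w\<in>W. \<pi> g *\<^sub>v w \<in> W)"

definition completely_reducible :: "'g set \<Rightarrow> nat \<Rightarrow> ('g \<Rightarrow> complex Matrix.mat) \<Rightarrow> bool" where
  "completely_reducible G d \<pi> \<longleftrightarrow>
     (\<forall>W. invariant_subspace G d \<pi> W \<longrightarrow>
        (\<exists>U. invariant_subspace G d \<pi> U \<and> W \<inter> U = {0\<^sub>v d} \<and>
           (\<forall>v\<in>carrier_vec d. \<exists>w\<in>W. \<exists>u\<in>U. v = w + u)))"

text \<open>As in the invariant theory of complex algebraic groups, reductive means that all
  finite-dimensional rational representations are completely reducible.\<close>

definition reductive_group :: "(complex ^ 'n ^ 'n) set \<Rightarrow> bool" where
  "reductive_group G \<longleftrightarrow> linear_algebraic_group G \<and>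
     (\<forall>d \<pi>. rational_representation G d \<pi> \<longrightarrow> completely_reducible G d \<pi>)"

end

theory Submission
  imports Defs "HOL-Library.Poly_Mapping" "HOL-Library.Multiset_Order"
begin

text \<open>The vertex algebra is identified, as a vector space, with the polynomial ring in variables \<open>x\<^sub>i\<^sub>,\<^sub>k\<close>
  (\<open>k \<ge> 0\<close>), where \<open>x\<^sub>i\<^sub>,\<^sub>k\<close> stands for \<open>\<alpha>\<^sup>i(-k-1)\<close>: infinitely many copies of the standard representation.
  Any vertex subalgebra containing \<open>\<omega>\<^sub>1 = \<Sum>\<^sub>i \<alpha>\<^sup>i(-1)\<alpha>\<^sup>i\<close> and \<open>\<omega>\<^sub>3 = \<Sum>\<^sub>i \<alpha>\<^sup>i(-3)\<alpha>\<^sup>i\<close> is closed under all polarization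
  operators \<open>\<Sum>\<^sub>i x\<^sub>i\<^sub>,\<^sub>p \<partial>/\<partial>x\<^sub>i\<^sub>,\<^sub>q\<close>, which can be separated from the modes of quadratic fields by interpolation.
  By Weyl's theorem on polarization the invariants are obtained by polarization from invariants of the first
  \<open>n\<close> copies, and these are governed by Hilbert's theorem: finitely many of them, \<open>f\<^sub>1, \<dots>, f\<^sub>r\<close>, generate
  the ideal of the others, with invariant coefficients as \<open>G\<close> is reductive. Finally \<open>P(-1)Q\<close> is \<open>PQ\<close> up to
  terms of lower degree, so \<open>\<omega>\<^sub>1\<close>, \<open>\<omega>\<^sub>3\<close>, \<open>f\<^sub>1, \<dots>, f\<^sub>r\<close> generate all invariants, by induction on the
  degree.\<close>

section \<open>Polynomials\<close>

text \<open>The vertex algebra is given only by axioms, so the polynomial model has to be derived: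
  generation makes the map from polynomials surjective, and the annihilating modes, which act as
  derivatives, make it injective. Two features let the induction on the degree close. Modes of
  quadratic fields yield the polarization operators exactly, without lower terms, and these keep the
  degree; hence Weyl's theorem applies to the invariants below a given degree. Only the product of
  two invariants needs a correction, and this is again invariant, as a difference of invariants. The
  choice of the two quadratic vectors has the following origin: mode 0 of
  \<open>\<omega>\<^sub>1\<close> is twice the translation operator, so
  \<open>\<Sum>\<^sub>i \<alpha>\<^sup>i(-2)\<alpha>\<^sup>i\<close> is a multiple of a derivative
  of \<open>\<omega>\<^sub>1\<close>, and \<open>\<omega>\<^sub>3\<close> is the first vector of
  this kind that translation does not reach. They are invariant because the matrices are
  orthogonal.\<close>

type_synonym 'x mpoly = "'x multiset \<Rightarrow>\<^sub>0 complex"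

abbreviation coef :: "'x mpoly \<Rightarrow> 'x multiset \<Rightarrow> complex" where
  "coef \<equiv> Poly_Mapping.lookup"

abbreviation mon :: "'x multiset \<Rightarrow> complex \<Rightarrow> 'x mpoly" where
  "mon \<equiv> Poly_Mapping.single"

abbreviation supp :: "'x mpoly \<Rightarrow> 'x multiset set" where
  "supp \<equiv> Poly_Mapping.keys"

abbreviation Var :: "'x \<Rightarrow> 'x mpoly" where
  "Var x \<equiv> mon {#x#} 1"

definition cmul :: "complex \<Rightarrow> 'x mpoly \<Rightarrow> 'x mpoly" where
  "cmul c P = mon {#} c * P"

lemma mpoly_sum_monom: "P = (\<Sum>m\<in>supp P. mon m (coef P m))"
proof (rule poly_mapping_eqI)
  fix k
  have "coef (\<Sum>m\<in>supp P. mon m (coef P m)) k = (\<Sum>m\<in>supp P. if m = k then coef P m else 0)"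
    by (simp add: lookup_sum lookup_single when_def)
  also have "\<dots> = coef P k"
    by (simp add: in_keys_iff)
  finally show "coef P k = coef (\<Sum>m\<in>supp P. mon m (coef P m)) k" by simp
qed

lemma mpoly_induct [case_names monom add]:
  assumes "\<And>m c. Q (mon m c)" and "\<And>P P'. Q P \<Longrightarrow> Q P' \<Longrightarrow> Q (P + P')"
  shows "Q (P :: 'x mpoly)"
proof -
  have "Q (\<Sum>m\<in>A. mon m (coef P m))" if "finite A" for A
    using that
  proof induction
    case empty
    show ?case using assms(1)[of "{#}" 0] by simp
  next
    case (insert x F)
    then show ?case using assms by simp
  qed
  from this[of "supp P"] show ?thesis
    using mpoly_sum_monom[of P] by simp
qed

lemma coef_monom_mult: "coef (mon a c * P) m = (if a \<subseteq># m then c * coef P (m - a) else 0)"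
proof (induction P rule: mpoly_induct)
  case (monom b d)
  have "a + b = m \<longleftrightarrow> a \<subseteq># m \<and> b = m - a"
    by (auto simp: subset_mset.add_diff_inverse)
  then show ?case
    by (auto simp: mult_single lookup_single when_def)
next
  case (add P P')
  then show ?case by (simp add: distrib_left lookup_add)
qed

lemma coef_X_mult: "coef (Var x * P) m = (if x \<in># m then coef P (m - {#x#}) else 0)"
  by (simp add: coef_monom_mult)

lemma coef_cmul [simp]: "coef (cmul c P) m = c * coef P m"
  by (simp add: cmul_def coef_monom_mult)

interpretation mp: vector_space "cmul :: complex \<Rightarrow> 'x mpoly \<Rightarrow> 'x mpoly"
  by unfold_locales (auto intro!: poly_mapping_eqI simp: lookup_add algebra_simps)

lemma cmul_monom: "cmul c (mon m d) = mon m (c * d)"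
  by (simp add: cmul_def mult_single)

lemma cmul_mult_left: "cmul c P * Q = cmul c (P * Q)"
  by (simp add: cmul_def mult.assoc)

lemma cmul_mult_right: "P * cmul c Q = cmul c (P * Q)"
  by (simp add: cmul_def algebra_simps)

lemma monom_eq_cmul: "mon m c = cmul c (mon m 1)"
  by (simp add: cmul_monom)

lemma keys_cmul_subset: "supp (cmul c P) \<subseteq> supp P"
  by (auto simp: in_keys_iff)

lemma keys_X_mult: "supp (Var x * P) = add_mset x ` supp P"
proof (intro Set.set_eqI)
  fix m
  show "m \<in> supp (Var x * P) \<longleftrightarrow> m \<in> add_mset x ` supp P"
    by (auto simp: in_keys_iff coef_X_mult image_iff intro!: bexI[of _ "m - {#x#}"])
qed

text \<open>Given by coefficients: the exponent of \<open>x\<close> in the source monomial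
  \<open>add_mset x m\<close> is \<open>count m x + 1\<close>. That the support is finite, without
  which \<open>Abs_poly_mapping\<close> says nothing, is shown in \<open>coef_pd\<close>.\<close>

definition pd :: "'x \<Rightarrow> 'x mpoly \<Rightarrow> 'x mpoly" where
  "pd x P = Abs_poly_mapping (\<lambda>m. of_nat (count m x + 1) * coef P (add_mset x m))"

lemma coef_pd: "coef (pd x P) m = of_nat (count m x + 1) * coef P (add_mset x m)"
proof -
  have "{m. coef P (add_mset x m) \<noteq> 0} = add_mset x -` supp P"
    by (auto simp: in_keys_iff)
  moreover have "finite (add_mset x -` supp P)"
    by (rule finite_vimageI) (auto simp: inj_def)
  ultimately have "finite {m. of_nat (count m x + 1) * coef P (add_mset x m) \<noteq> 0}"
    by (auto elim: rev_finite_subset)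
  then show ?thesis unfolding pd_def by simp
qed

lemma pd_add: "pd x (P + Q) = pd x P + pd x Q"
  by (auto intro!: poly_mapping_eqI simp: coef_pd lookup_add algebra_simps)

lemma pd_cmul: "pd x (cmul c P) = cmul c (pd x P)"
  by (auto intro!: poly_mapping_eqI simp: coef_pd algebra_simps)

lemma pd_X_mult: "pd x (Var y * P) = (if x = y then P else 0) + Var y * pd x P"
proof (rule poly_mapping_eqI)
  fix m
  show "coef (pd x (Var y * P)) m = coef ((if x = y then P else 0) + Var y * pd x P) m"
  proof (cases "x = y")
    case True
    show ?thesis
    proof (cases "y \<in># m")
      case mem: True
      then have "Suc (count m y - Suc 0) = count m y" by simp
      then have "1 + of_nat (count m y - Suc 0) = (of_nat (count m y) :: complex)"
        by (metis of_nat_Suc)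
      with mem True show ?thesis
        by (simp add: coef_pd coef_X_mult lookup_add distrib_right)
    qed (auto simp: True coef_pd coef_X_mult lookup_add count_eq_zero_iff)
  next
    case False
    then show ?thesis
      by (auto simp: coef_pd coef_X_mult lookup_add diff_add_mset_swap)
  qed
qed

lemma pd_monom_empty [simp]: "pd x (mon {#} c) = 0"
  by (auto intro!: poly_mapping_eqI simp: coef_pd lookup_single)

lemma keys_pd: "supp (pd x P) = {m. add_mset x m \<in> supp P}"
  by (auto simp: in_keys_iff coef_pd simp flip: of_nat_Suc)

lemma pd_eq_0_iff: "pd x P = 0 \<longleftrightarrow> (\<forall>m\<in>supp P. x \<notin># m)"
proof -
  have "pd x P = 0 \<longleftrightarrow> supp (pd x P) = {}" by simp
  also have "\<dots> \<longleftrightarrow> (\<forall>m\<in>supp P. x \<notin># m)"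
    unfolding keys_pd by (auto dest!: multi_member_split)
  finally show ?thesis .
qed

definition vars_in :: "'x set \<Rightarrow> 'x mpoly \<Rightarrow> bool" where
  "vars_in V P \<longleftrightarrow> (\<forall>m\<in>supp P. set_mset m \<subseteq> V)"

text \<open>The bound is strict, so that \<open>deg_less 0\<close> leaves only the zero polynomial,
  where the inductions on the degree start.\<close>

definition deg_less :: "nat \<Rightarrow> 'x mpoly \<Rightarrow> bool" where
  "deg_less d P \<longleftrightarrow> (\<forall>m\<in>supp P. size m < d)"

section \<open>Polarization\<close>

definition mfact :: "'x multiset \<Rightarrow> nat" where
  "mfact m = (\<Prod>x\<in>set_mset m. fact (count m x))"

lemma mfact_pos: "mfact m > 0"
  by (simp add: mfact_def prod_pos)

lemma mfact_superset: "finite A \<Longrightarrow> set_mset m \<subseteq> A \<Longrightarrow> mfact m = (\<Prod>x\<in>A. fact (count m x))"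
  unfolding mfact_def by (rule prod.mono_neutral_left) (auto simp: not_in_iff)

lemma mfact_add_mset: "mfact (add_mset x m) = (count m x + 1) * mfact m"
proof -
  let ?A = "insert x (set_mset m)"
  have "mfact (add_mset x m) = (\<Prod>y\<in>?A. fact (count (add_mset x m) y))"
    by (rule mfact_superset) auto
  also have "\<dots> = (count m x + 1) * (\<Prod>y\<in>?A. fact (count m y))"
  proof -
    have "(\<Prod>y\<in>?A - {x}. fact (count (add_mset x m) y)) = (\<Prod>y\<in>?A - {x}. fact (count m y) :: nat)"
      by (intro prod.cong) auto
    then show ?thesis
      by (subst (1 2) prod.remove[of _ x]) (simp_all add: algebra_simps)
  qed
  also have "(\<Prod>y\<in>?A. fact (count m y)) = mfact m"
    by (rule mfact_superset[symmetric]) auto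
  finally show ?thesis .
qed

text \<open>The Fischer inner product, for which multiplication by a variable is adjoint to the derivative, hence
  \<open>polarize p q\<close> to \<open>polarize q p\<close>.\<close>

definition fischer :: "'x mpoly \<Rightarrow> 'x mpoly \<Rightarrow> complex" where
  "fischer f g = (\<Sum>m\<in>supp f. of_nat (mfact m) * cnj (coef f m) * coef g m)"

lemma fischer_eq:
  assumes "finite A" "supp f \<subseteq> A"
  shows "fischer f g = (\<Sum>m\<in>A. of_nat (mfact m) * cnj (coef f m) * coef g m)"
  unfolding fischer_def using assms by (intro sum.mono_neutral_left) (auto simp: in_keys_iff)

lemma fischer_add_left: "fischer (f + f') g = fischer f g + fischer f' g"
proof -
  let ?A = "supp f \<union> supp f'"
  have *: "fischer h g = (\<Sum>m\<in>?A. of_nat (mfact m) * cnj (coef h m) * coef g m)"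
    if "supp h \<subseteq> ?A" for h
    by (rule fischer_eq) (use that in auto)
  show ?thesis
    by (subst (1 2 3) *) (auto simp: lookup_add algebra_simps sum.distrib dest: keys_add[THEN subsetD])
qed

lemma fischer_add_right: "fischer f (g + g') = fischer f g + fischer f g'"
  by (simp add: fischer_def lookup_add algebra_simps sum.distrib)

lemma fischer_diff_right: "fischer f (g - g') = fischer f g - fischer f g'"
  by (simp add: fischer_def lookup_minus algebra_simps sum_subtractf)

lemma fischer_cmul_right: "fischer f (cmul c g) = c * fischer f g"
  by (simp add: fischer_def sum_distrib_left algebra_simps)

lemma fischer_0_left [simp]: "fischer 0 g = 0"
  by (simp add: fischer_def)

lemma fischer_0_right [simp]: "fischer f 0 = 0"
  by (simp add: fischer_def)

lemma fischer_commute: "fischer g f = cnj (fischer f g)"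
proof -
  let ?A = "supp f \<union> supp g"
  have "fischer g f = (\<Sum>m\<in>?A. of_nat (mfact m) * cnj (coef g m) * coef f m)"
    by (rule fischer_eq) auto
  moreover have "fischer f g = (\<Sum>m\<in>?A. of_nat (mfact m) * cnj (coef f m) * coef g m)"
    by (rule fischer_eq) auto
  ultimately show ?thesis by (simp add: algebra_simps)
qed

lemma fischer_cmul_left: "fischer (cmul c f) g = cnj c * fischer f g"
  by (subst (1 2) fischer_commute) (simp add: fischer_cmul_right)

lemma fischer_sum_right: "fischer f (sum g A) = (\<Sum>a\<in>A. fischer f (g a))"
  by (induction A rule: infinite_finite_induct) (auto simp: fischer_add_right)

lemma fischer_sum_left: "fischer (sum f A) g = (\<Sum>a\<in>A. fischer (f a) g)"
  by (induction A rule: infinite_finite_induct) (auto simp: fischer_add_left)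

text \<open>The weights are positive and the first argument is conjugated, so the form is a positive
  definite Hermitian one; orthogonal complements depend on this.\<close>

lemma fischer_self_eq_0: "fischer f f = 0 \<longleftrightarrow> f = 0"
proof
  assume 0: "fischer f f = 0"
  have "fischer f f = of_real (\<Sum>m\<in>supp f. real (mfact m) * (cmod (coef f m))\<^sup>2)"
    unfolding fischer_def of_real_sum
    by (intro sum.cong) (simp_all add: complex_norm_square mult.assoc mult.commute del: of_real_power)
  with 0 have "(\<Sum>m\<in>supp f. real (mfact m) * (cmod (coef f m))\<^sup>2) = 0"
    by (metis of_real_eq_0_iff)
  then have "\<forall>m\<in>supp f. real (mfact m) * (cmod (coef f m))\<^sup>2 = 0"
    by (subst (asm) sum_nonneg_eq_0_iff) auto
  then have "coef f m = 0" if "m \<in> supp f" for m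
    using that mfact_pos[of m] by fastforce
  then have "m \<notin> supp f" for m
    by (auto simp: in_keys_iff)
  then show "f = 0" by (metis keys_eq_empty equals0I)
qed simp

text \<open>Adding \<open>x\<close> to \<open>m\<close> multiplies the weight \<open>mfact m\<close>
  by \<open>count m x + 1\<close>, which is the factor that the derivative brings down.\<close>

lemma fischer_X_mult_left: "fischer (Var x * f) g = fischer f (pd x g)"
proof -
  have "fischer (Var x * f) g = (\<Sum>m\<in>supp f. of_nat (mfact (add_mset x m)) * cnj (coef f m) * coef g (add_mset x m))"
    unfolding fischer_def keys_X_mult by (subst sum.reindex) (auto simp: inj_on_def coef_X_mult)
  then show ?thesis
    unfolding fischer_def by (simp add: mfact_add_mset coef_pd algebra_simps)
qed

lemma fischer_pd_left: "fischer (pd x f) g = fischer f (Var x * g)"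
  by (subst (1 2) fischer_commute) (simp add: fischer_X_mult_left)

text \<open>One step of Gram-Schmidt: \<open>t\<close> is replaced by its component
  \<open>?t\<close> orthogonal to \<open>T\<close>, and the approximation to \<open>f\<close> is
  corrected along \<open>?t\<close>.\<close>

lemma fischer_decompose:
  assumes "finite T"
  shows "\<exists>u\<in>mp.span T. \<forall>t\<in>T. fischer t (f - u) = 0"
  using assms
proof (induction T arbitrary: f)
  case empty
  then show ?case by auto
next
  case (insert t T)
  have orth: "fischer w h = 0" if "\<forall>s\<in>T. fischer s h = 0" "w \<in> mp.span T" for w h
    using that(2)
    by (induction rule: mp.span_induct_alt)
      (use that(1) in \<open>auto simp: fischer_add_left fischer_cmul_left\<close>)
  obtain u where u: "u \<in> mp.span T" "\<forall>s\<in>T. fischer s (f - u) = 0"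
    using insert.IH by blast
  obtain w where w: "w \<in> mp.span T" "\<forall>s\<in>T. fischer s (t - w) = 0"
    using insert.IH by blast
  let ?t = "t - w"
  \<comment> \<open>If \<open>?t = 0\<close>, then \<open>t\<close> already lies in the span of
    \<open>T\<close>; division by zero gives \<open>c = 0\<close>, and nothing is corrected.\<close>
  define c where "c = fischer ?t (f - u) / fischer ?t ?t"
  let ?u = "u + cmul c ?t"
  have sub: "mp.span T \<subseteq> mp.span (insert t T)"
    by (rule mp.span_mono) auto
  have "?u \<in> mp.span (insert t T)"
    using u(1) w(1) sub by (intro mp.span_add mp.span_scale mp.span_diff) (auto intro: mp.span_base)
  moreover have T: "fischer s (f - ?u) = 0" if "s \<in> T" for s
  proof -
    have "f - ?u = (f - u) - cmul c ?t" by simp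
    then show ?thesis using that u(2) w(2) by (simp only: fischer_diff_right fischer_cmul_right) simp
  qed
  moreover have "fischer t (f - ?u) = 0"
  proof -
    have "fischer w (f - ?u) = 0" using T w(1) by (intro orth) auto
    moreover have "fischer ?t (f - ?u) = 0"
    proof -
      have "f - ?u = (f - u) - cmul c ?t" by simp
      then have "fischer ?t (f - ?u) = fischer ?t (f - u) - c * fischer ?t ?t"
        by (simp only: fischer_diff_right fischer_cmul_right)
      also have "\<dots> = 0"
        by (cases "?t = 0") (auto simp: c_def fischer_self_eq_0 simp del: right_minus_eq)
      finally show ?thesis .
    qed
    ultimately have "fischer (?t + w) (f - ?u) = 0" by (simp only: fischer_add_left) simp
    then show ?thesis by simp
  qed
  ultimately show ?case by (intro bexI[of _ ?u]) auto
qed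

text \<open>The derivation that sends the variables of copy \<open>q\<close> to those of copy
  \<open>p\<close> and kills the other copies: an elementary matrix of the general linear Lie
  algebra on the index of the copies.\<close>

definition polarize :: "nat \<Rightarrow> nat \<Rightarrow> ('n::finite \<times> nat) mpoly \<Rightarrow> ('n \<times> nat) mpoly" where
  "polarize p q f = (\<Sum>i\<in>UNIV. Var (i, p) * pd (i, q) f)"

lemma fischer_pol_left: "fischer (polarize p q f) g = fischer f (polarize q p g)"
  by (simp add: polarize_def fischer_sum_left fischer_sum_right fischer_X_mult_left fischer_pd_left)

lemma keys_polD:
  assumes "m \<in> supp (polarize p q f)"
  obtains i m' where "m = add_mset (i, p) m'" "add_mset (i, q) m' \<in> supp f"
proof -
  from assms obtain i where "m \<in> supp (Var (i, p) * pd (i, q) f)"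
    unfolding polarize_def using keys_sum[of "\<lambda>i. Var (i, p) * pd (i, q) f" UNIV] by blast
  then show thesis using that by (auto simp: keys_X_mult keys_pd)
qed

text \<open>Instead of using Cramer's rule, look at a monomial of some \<open>u j\<close> with the largest number of diagonal
  variables \<open>(i, e i)\<close>: its product with the diagonal variable of row \<open>j\<close> cannot cancel.\<close>

lemma generic_matrix_kernel:
  fixes e :: "'n::finite \<Rightarrow> nat" and u :: "'n \<Rightarrow> ('n \<times> nat) mpoly"
  assumes e: "inj e"
    and eq: "\<And>i. (\<Sum>j\<in>UNIV. Var (j, e i) * u j) = 0"
  shows "u j = 0"
proof (rule ccontr)
  assume "u j \<noteq> 0"
  define dd :: "('n \<times> nat) multiset \<Rightarrow> nat"
    where "dd m = size (filter_mset (\<lambda>x. snd x = e (fst x)) m)" for m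
  define S where "S = (\<Union>j. supp (u j))"
  have fin: "finite S" by (simp add: S_def)
  have "S \<noteq> {}" using \<open>u j \<noteq> 0\<close> by (force simp: S_def)
  then have "Max (dd ` S) \<in> dd ` S" using fin by simp
  then obtain m0 where m0: "m0 \<in> S" "dd m0 = Max (dd ` S)" by auto
  then obtain i0 where i0: "m0 \<in> supp (u i0)" by (auto simp: S_def)
  let ?x = "(i0, e i0)"
  let ?m = "add_mset ?x m0"
  have "coef (Var (j, e i0) * u j) ?m = 0" if "j \<noteq> i0" for j
  proof (rule ccontr)
    assume ne: "coef (Var (j, e i0) * u j) ?m \<noteq> 0"
    let ?m' = "?m - {#(j, e i0)#}"
    from ne have mem: "(j, e i0) \<in># ?m" and "?m' \<in> supp (u j)"
      by (auto simp: coef_X_mult in_keys_iff split: if_splits)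
    then have "?m' \<in> S" by (auto simp: S_def)
    then have le: "dd ?m' \<le> dd m0" using fin m0(2) by simp
    \<comment> \<open>As \<open>e\<close> is injective, \<open>(j, e i0)\<close> is off the
      diagonal; its removal keeps the number of diagonal variables, which in \<open>?m\<close>
      exceeds the maximum by one.\<close>
    have "?m = add_mset (j, e i0) ?m'" using mem by simp
    then have "dd ?m = dd ?m'" using e that by (auto simp: dd_def inj_eq dest!: arg_cong[where f = dd])
    with le show False by (simp add: dd_def)
  qed
  then have "(\<Sum>j\<in>UNIV. coef (Var (j, e i0) * u j) ?m) = coef (Var ?x * u i0) ?m"
    by (subst sum.remove[of _ i0]) auto
  also have "\<dots> = coef (u i0) m0" by (simp add: coef_X_mult)
  finally have "coef (\<Sum>j\<in>UNIV. Var (j, e i0) * u j) ?m = coef (u i0) m0"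
    by (simp add: lookup_sum)
  then show False using eq i0 by (simp add: in_keys_iff)
qed

lemma finite_multisets_bounded:
  assumes "finite A"
  shows "finite {m. set_mset m \<subseteq> A \<and> size m \<le> d}"
proof -
  have "{m. set_mset m \<subseteq> A \<and> size m \<le> d} \<subseteq> mset ` {xs. set xs \<subseteq> A \<and> length xs \<le> d}"
  proof
    fix m assume m: "m \<in> {m. set_mset m \<subseteq> A \<and> size m \<le> d}"
    obtain xs where "mset xs = m" using ex_mset by blast
    with m show "m \<in> mset ` {xs. set xs \<subseteq> A \<and> length xs \<le> d}" by (auto intro!: image_eqI[of _ _ xs])
  qed
  then show ?thesis
    using finite_lists_length_le[OF assms] by (rule finite_subset[OF _ finite_imageI])
qed

lemma mpoly_in_span_monoms:
  assumes "supp f \<subseteq> K"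
  shows "f \<in> mp.span ((\<lambda>m. mon m 1) ` K)"
proof -
  have "f = (\<Sum>m\<in>supp f. cmul (coef f m) (mon m 1))"
    by (subst mpoly_sum_monom) (simp add: cmul_monom)
  also have "\<dots> \<in> mp.span ((\<lambda>m. mon m 1) ` K)"
    using assms by (intro mp.span_sum mp.span_scale mp.span_base) auto
  finally show ?thesis .
qed

text \<open>Weyl's theorem. An element orthogonal to everything that is obtained from the first \<open>n\<close> copies, and of
  lowest weight among those, is killed by \<open>polarize p q\<close> for \<open>p < q\<close>; so it involves only the first \<open>n\<close>
  copies, as the generic \<open>n \<times> n\<close> matrix has trivial kernel.\<close>

theorem polarization_from_few_copies:
  fixes F B :: "('n::finite \<times> nat) mpoly set"
  assumes e: "bij_betw e (UNIV :: 'n set) {..<n}"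
    and F: "mp.subspace F" "\<And>p q f. f \<in> F \<Longrightarrow> polarize p q f \<in> F"
    and B: "mp.subspace B" "\<And>p q f. f \<in> B \<Longrightarrow> polarize p q f \<in> B"
    and base: "\<And>f. f \<in> F \<Longrightarrow> vars_in (UNIV \<times> {..<n}) f \<Longrightarrow> f \<in> B"
    and "f \<in> F"
  shows "f \<in> B"
proof -
  define V where "V = (\<Union>m\<in>supp f. set_mset m)"
  define M where "M = Suc (Max (insert 0 (snd ` V)))"
  define d where "d = Max (insert 0 (size ` supp f))"
  have finV: "finite V" by (simp add: V_def)
  have VM: "V \<subseteq> UNIV \<times> {..<M}"
  proof
    fix x assume "x \<in> V"
    then have "snd x \<le> Max (insert 0 (snd ` V))" using finV by (intro Max_ge) auto
    then show "x \<in> UNIV \<times> {..<M}" by (cases x) (simp add: M_def)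
  qed
  \<comment> \<open>Orthogonal decomposition needs a finite-dimensional space. The copies below
    \<open>M\<close> and the degrees up to \<open>d\<close> contain \<open>f\<close> and are stable
    under polarization into copies below \<open>M\<close>.\<close>
  define K where "K = {m :: ('n \<times> nat) multiset. set_mset m \<subseteq> UNIV \<times> {..<M} \<and> size m \<le> d}"
  have finK: "finite K" unfolding K_def by (rule finite_multisets_bounded) auto
  define F' where "F' = {h \<in> F. supp h \<subseteq> K}"
  have fF': "f \<in> F'"
    using \<open>f \<in> F\<close> VM by (auto simp: F'_def K_def d_def V_def)
  have F'_sub: "mp.subspace F'"
    unfolding mp.subspace_def
  proof (intro conjI ballI allI)
    show "0 \<in> F'" using F(1) by (simp add: F'_def mp.subspace_0)
  next
    fix g h assume "g \<in> F'" "h \<in> F'"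
    then show "g + h \<in> F'"
      using F(1) keys_add[of g h] by (auto simp: F'_def mp.subspace_add)
  next
    fix c h assume "h \<in> F'"
    then show "cmul c h \<in> F'"
      using F(1) keys_cmul_subset[of c h] by (auto simp: F'_def mp.subspace_scale)
  qed
  have F'_pol: "polarize p q h \<in> F'" if "h \<in> F'" "p < M" for p q h
  proof -
    have "m \<in> K" if "m \<in> supp (polarize p q h)" for m
      using that
    proof (rule keys_polD)
      fix i m' assume "m = add_mset (i, p) m'" "add_mset (i, q) m' \<in> supp h"
      moreover from this have "add_mset (i, q) m' \<in> K" using \<open>h \<in> F'\<close> by (auto simp: F'_def)
      ultimately show "m \<in> K" using \<open>p < M\<close> by (auto simp: K_def)
    qed
    then have "supp (polarize p q h) \<subseteq> K" by blast
    moreover have "polarize p q h \<in> F" using that(1) F(2) by (simp add: F'_def)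
    ultimately show ?thesis by (simp add: F'_def)
  qed
  define M' where "M' = F' \<inter> B"
  have M'_sub: "mp.subspace M'"
    unfolding M'_def using F'_sub B(1) by (rule mp.subspace_inter)
  obtain T where T: "T \<subseteq> M'" "mp.independent T" "M' \<subseteq> mp.span T"
    using mp.basis_exists[of M'] by metis
  have "T \<subseteq> mp.span ((\<lambda>m. mon m 1) ` K)"
    using T(1) mpoly_in_span_monoms by (auto simp: M'_def F'_def)
  then have "finite T"
    using mp.independent_span_bound[OF finite_imageI[OF finK] T(2)] by simp
  have spanT: "mp.span T = M'"
    using T M'_sub by (simp add: mp.span_minimal subset_antisym)
  obtain u where u: "u \<in> mp.span T" "\<forall>t\<in>T. fischer t (f - u) = 0"
    using fischer_decompose[OF \<open>finite T\<close>, of f] by auto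
  define N where "N = {h \<in> F'. \<forall>t\<in>M'. fischer t h = 0}"
  have "fischer t (f - u) = 0" if "t \<in> mp.span T" for t
    using that
    by (induction rule: mp.span_induct_alt) (use u(2) in \<open>auto simp: fischer_add_left fischer_cmul_left\<close>)
  then have fuN: "f - u \<in> N"
    unfolding N_def using fF' u(1) F'_sub spanT by (auto simp: M'_def intro: mp.subspace_diff)
  \<comment> \<open>The weight is the sum of the copy indices; \<open>polarize p q\<close> with
    \<open>p < q\<close> lowers the weight of every monomial by \<open>q - p\<close>.\<close>
  define wt :: "('n \<times> nat) multiset \<Rightarrow> nat" where "wt m = sum_mset (image_mset snd m)" for m
  have "N \<subseteq> {0}"
  proof (rule ccontr)
    assume "\<not> N \<subseteq> {0}"
    then obtain h0 where "h0 \<in> N \<and> h0 \<noteq> 0" by auto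
    from ex_has_least_nat[of "\<lambda>h. h \<in> N \<and> h \<noteq> 0" h0 "\<lambda>h. Max (wt ` supp h)", OF this]
    obtain h where h: "h \<in> N" "h \<noteq> 0"
      and min: "\<And>h'. h' \<in> N \<Longrightarrow> h' \<noteq> 0 \<Longrightarrow> Max (wt ` supp h) \<le> Max (wt ` supp h')"
      by auto
    have zero: "polarize p q h = 0" if "p < q" "q < M" for p q
    proof (rule ccontr)
      assume ne: "polarize p q h \<noteq> 0"
      \<comment> \<open>\<open>M'\<close> is stable under the adjoint \<open>polarize q p\<close>,
        so its orthogonal complement is stable under \<open>polarize p q\<close>.\<close>
      have "fischer t (polarize p q h) = 0" if "t \<in> M'" for t
      proof -
        have "polarize q p t \<in> M'" using that F'_pol[of t q p] B(2) \<open>q < M\<close> by (auto simp: M'_def)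
        then have "fischer (polarize q p t) h = 0" using h(1) by (auto simp: N_def)
        then show ?thesis by (simp add: fischer_pol_left)
      qed
      then have "polarize p q h \<in> N"
        using h(1) F'_pol[of h p q] that by (auto simp: N_def)
      then have le: "Max (wt ` supp h) \<le> Max (wt ` supp (polarize p q h))" using ne by (rule min)
      have "Max (wt ` supp (polarize p q h)) \<in> wt ` supp (polarize p q h)" using ne by (intro Max_in) auto
      then obtain m where m: "m \<in> supp (polarize p q h)" "wt m = Max (wt ` supp (polarize p q h))" by auto
      from m(1) obtain i m' where m': "m = add_mset (i, p) m'" "add_mset (i, q) m' \<in> supp h"
        by (rule keys_polD)
      have "wt (add_mset (i, q) m') \<le> Max (wt ` supp h)" using m'(2) by (intro Max_ge) auto
      with le m m'(1) \<open>p < q\<close> show False by (simp add: wt_def)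
    qed
    have "pd (i, q) h = 0" if "q \<ge> n" for i q
    proof (cases "q < M")
      case True
      have inj: "inj e" using e by (rule bij_betw_imp_inj_on)
      show ?thesis
      proof (rule generic_matrix_kernel[OF inj, where u = "\<lambda>i. pd (i, q) h"])
        fix j
        have "e j \<in> {..<n}" using e by (auto simp: bij_betw_def)
        then have "e j < q" using that by simp
        then show "(\<Sum>i\<in>UNIV. Var (i, e j) * pd (i, q) h) = 0"
          using zero[of "e j" q] True by (simp add: polarize_def)
      qed
    next
      case False
      then show ?thesis using h(1) by (force simp: pd_eq_0_iff N_def F'_def K_def)
    qed
    then have "vars_in (UNIV \<times> {..<n}) h"
      by (force simp: vars_in_def pd_eq_0_iff not_le[symmetric])
    \<comment> \<open>Now \<open>h\<close> lies both in \<open>M'\<close> and in its orthogonal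
      complement.\<close>
    then have "h \<in> M'" using h(1) base by (auto simp: N_def M'_def F'_def)
    then have "fischer h h = 0" using h(1) by (auto simp: N_def)
    then show False using h(2) by (simp add: fischer_self_eq_0)
  qed
  then have "f = u" using fuN by auto
  then show ?thesis using u(1) spanT by (auto simp: M'_def)
qed

section \<open>Hilbert's basis theorem\<close>

lemma ex_mono_subseq_nat:
  fixes s :: "nat \<Rightarrow> nat"
  shows "\<exists>r::nat \<Rightarrow> nat. strict_mono r \<and> mono (\<lambda>k. s (r k))"
proof -
  obtain f :: "nat \<Rightarrow> nat" where f: "strict_mono f" "monoseq (\<lambda>n. s (f n))"
    using seq_monosub by blast
  from f(2) consider "\<forall>m. \<forall>n\<ge>m. s (f m) \<le> s (f n)" | (dec) "\<forall>m. \<forall>n\<ge>m. s (f n) \<le> s (f m)"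
    unfolding monoseq_def by blast
  then show ?thesis
  proof cases
    case 1
    then show ?thesis using f(1) by (intro exI[of _ f]) (auto simp: mono_def)
  next
    case dec
    \<comment> \<open>A decreasing sequence of naturals is constant from the index of its minimum
      on, and a constant sequence is monotone.\<close>
    obtain k where k: "\<And>n. s (f k) \<le> s (f n)"
      using ex_has_least_nat[of "\<lambda>_. True" 0 "\<lambda>n. s (f n)"] by auto
    have "s (f (n + k)) = s (f k)" for n
      using k[of "n + k"] dec[rule_format, of k "n + k"] by auto
    then have "mono (\<lambda>n. s (f (n + k)))" by (simp add: mono_def)
    moreover have "strict_mono (\<lambda>n. f (n + k))"
      using f(1) by (simp add: strict_mono_def)
    ultimately show ?thesis by (intro exI[of _ "\<lambda>n. f (n + k)"]) simp
  qed
qed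

text \<open>One variable at a time: passing to a further subsequence keeps the exponents monotone
  that already are.\<close>

lemma ex_mono_subseq_multiset:
  fixes s :: "nat \<Rightarrow> 'x multiset"
  assumes "finite V"
  shows "\<exists>r::nat \<Rightarrow> nat. strict_mono r \<and> (\<forall>x\<in>V. mono (\<lambda>k. count (s (r k)) x))"
  using assms
proof induction
  case empty
  show ?case by (intro exI[of _ id]) (auto simp: strict_mono_def)
next
  case (insert x V)
  then obtain r :: "nat \<Rightarrow> nat" where r: "strict_mono r" "\<forall>x\<in>V. mono (\<lambda>k. count (s (r k)) x)" by blast
  obtain r' :: "nat \<Rightarrow> nat" where r': "strict_mono r'" "mono (\<lambda>k. count (s (r (r' k))) x)"
    using ex_mono_subseq_nat[of "\<lambda>k. count (s (r k)) x"] by blast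
  have "mono (\<lambda>k. count (s (r (r' k))) y)" if "y \<in> V" for y
    using r(2) that strict_mono_mono[OF r'(1)] by (auto simp: mono_def)
  then show ?case
    using r r' by (intro exI[of _ "r \<circ> r'"]) (auto simp: strict_mono_def)
qed

text \<open>\<open>L0\<close> consists of the minimal elements. Infinitely many of them would
  contain a sequence of distinct ones with a subsequence growing in every exponent, so that two
  distinct minimal elements would be comparable.\<close>

lemma dickson:
  fixes L :: "'x multiset set"
  assumes "finite V" and L: "\<And>m. m \<in> L \<Longrightarrow> set_mset m \<subseteq> V"
  shows "\<exists>L0\<subseteq>L. finite L0 \<and> (\<forall>m\<in>L. \<exists>m0\<in>L0. m0 \<subseteq># m)"
proof -
  define L0 where "L0 = {m \<in> L. \<forall>m'\<in>L. m' \<subseteq># m \<longrightarrow> m' = m}"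
  have "finite L0"
  proof (rule ccontr)
    assume "infinite L0"
    then obtain s :: "nat \<Rightarrow> 'x multiset" where s: "inj s" "range s \<subseteq> L0"
      using infinite_countable_subset by blast
    obtain r :: "nat \<Rightarrow> nat" where r: "strict_mono r" "\<forall>x\<in>V. mono (\<lambda>k. count (s (r k)) x)"
      using ex_mono_subseq_multiset[OF assms(1)] by blast
    have sL: "s k \<in> L0" for k using s(2) by auto
    have "s (r 0) \<subseteq># s (r 1)"
      unfolding subseteq_mset_def
    proof
      fix x
      show "count (s (r 0)) x \<le> count (s (r 1)) x"
      proof (cases "x \<in> V")
        case True
        then show ?thesis using r(2) by (auto simp: mono_def)
      next
        case False
        then have "x \<notin># s (r 0)" using L sL[of "r 0"] by (auto simp: L0_def)
        then show ?thesis by (simp add: not_in_iff)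
      qed
    qed
    then have "s (r 0) = s (r 1)" using sL[of "r 0"] sL[of "r 1"] by (auto simp: L0_def)
    moreover have "r 0 < r 1" using r(1) by (simp add: strict_mono_def)
    ultimately show False using s(1) by (auto dest: injD)
  qed
  moreover have "\<exists>m0\<in>L0. m0 \<subseteq># m" if mL: "m \<in> L" for m
  proof -
    obtain m0 where m0: "m0 \<in> L" "m0 \<subseteq># m"
      and min: "\<And>m'. m' \<in> L \<Longrightarrow> m' \<subseteq># m \<Longrightarrow> size m0 \<le> size m'"
      using ex_has_least_nat[of "\<lambda>m'. m' \<in> L \<and> m' \<subseteq># m" m size] mL by blast
    have "m' = m0" if "m' \<in> L" "m' \<subseteq># m0" for m'
    proof (rule ccontr)
      assume "m' \<noteq> m0"
      then have "size m' < size m0" using that(2) by (intro mset_subset_size) auto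
      moreover have "size m0 \<le> size m'" using that m0(2) by (intro min) auto
      ultimately show False by simp
    qed
    then show ?thesis using m0 by (auto simp: L0_def)
  qed
  ultimately show ?thesis by (intro exI[of _ L0]) (auto simp: L0_def)
qed

text \<open>The module generated by \<open>S\<close> over the polynomials in \<open>V\<close>, an
  ideal of their ring if \<open>S\<close> consists of such polynomials. Written as a linear span of
  monomial multiples, it is open to induction over spans.\<close>

definition ideal_in :: "'x set \<Rightarrow> 'x mpoly set \<Rightarrow> 'x mpoly set" where
  "ideal_in V S = mp.span {mon m 1 * s | m s. set_mset m \<subseteq> V \<and> s \<in> S}"

lemma ideal_inI: "set_mset m \<subseteq> V \<Longrightarrow> s \<in> S \<Longrightarrow> mon m 1 * s \<in> ideal_in V S"
  unfolding ideal_in_def by (rule mp.span_base) blast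

lemma ideal_in_base: "s \<in> S \<Longrightarrow> s \<in> ideal_in V S"
  using ideal_inI[of "{#}" V s S] by simp

lemma ideal_in_mono: "S \<subseteq> T \<Longrightarrow> ideal_in V S \<subseteq> ideal_in V T"
  unfolding ideal_in_def by (rule mp.span_mono) blast

lemma ideal_in_mult:
  assumes "f \<in> ideal_in V S" "set_mset m \<subseteq> V"
  shows "mon m 1 * f \<in> ideal_in V S"
  using assms(1) unfolding ideal_in_def
proof (induction rule: mp.span_induct_alt)
  case base
  show ?case by (simp add: mp.span_zero)
next
  case (step c x y)
  then obtain m' s where x: "x = mon m' 1 * s" "set_mset m' \<subseteq> V" "s \<in> S" by blast
  have "mon m 1 * x = mon (m + m') 1 * s" by (simp add: x mult_single flip: mult.assoc)
  then have "mon m 1 * x \<in> mp.span {mon m 1 * s | m s. set_mset m \<subseteq> V \<and> s \<in> S}"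
    using x assms(2) ideal_inI[of "m + m'" V s S] by (simp add: ideal_in_def)
  then show ?case using step
    by (simp add: distrib_left cmul_mult_right mp.span_add mp.span_scale)
qed

lemma ideal_in_subset:
  assumes "T \<subseteq> ideal_in V S"
  shows "ideal_in V T \<subseteq> ideal_in V S"
proof -
  have "{mon m 1 * s | m s. set_mset m \<subseteq> V \<and> s \<in> T} \<subseteq> ideal_in V S"
    using assms ideal_in_mult by blast
  then show ?thesis
    unfolding ideal_in_def[of V T] by (rule mp.span_minimal) (simp add: ideal_in_def)
qed

lemma ideal_in_vars:
  assumes "f \<in> ideal_in V S" "\<And>s. s \<in> S \<Longrightarrow> vars_in V s"
  shows "vars_in V f"
  using assms(1) unfolding ideal_in_def
proof (induction rule: mp.span_induct_alt)
  case base
  show ?case by (simp add: vars_in_def)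
next
  case (step c x y)
  then obtain m' s where x: "x = mon m' 1 * s" "set_mset m' \<subseteq> V" "s \<in> S" by blast
  have "vars_in V x"
    unfolding vars_in_def
  proof
    fix m assume "m \<in> supp x"
    then obtain m'' where "m = m' + m''" "m'' \<in> supp s"
      using x(1) keys_mult[of "mon m' 1" s] by auto
    then show "set_mset m \<subseteq> V" using x(2) assms(2)[OF x(3)] by (auto simp: vars_in_def)
  qed
  moreover have "supp (cmul c x + y) \<subseteq> supp x \<union> supp y"
    using keys_add[of "cmul c x" y] keys_cmul_subset[of c x] by blast
  ultimately show ?case using step.IH unfolding vars_in_def by blast
qed

lemma ideal_in_finite:
  assumes "f \<in> ideal_in V S"
  shows "\<exists>T\<subseteq>S. finite T \<and> f \<in> ideal_in V T"
  using assms unfolding ideal_in_def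
proof (induction rule: mp.span_induct_alt)
  case base
  show ?case by (intro exI[of _ "{}"]) (auto simp: mp.span_zero)
next
  case (step c x y)
  then obtain m s where x: "x = mon m 1 * s" "set_mset m \<subseteq> V" "s \<in> S" by blast
  from step obtain T where T: "T \<subseteq> S" "finite T" "y \<in> ideal_in V T" by (auto simp: ideal_in_def)
  have "x \<in> ideal_in V (insert s T)" using x by (simp add: ideal_inI)
  moreover have "y \<in> ideal_in V (insert s T)" using T ideal_in_mono[of T "insert s T"] by blast
  ultimately have "cmul c x + y \<in> ideal_in V (insert s T)"
    unfolding ideal_in_def by (intro mp.span_add mp.span_scale)
  then show ?case using T x(3) by (intro exI[of _ "insert s T"]) (auto simp: ideal_in_def)
qed

text \<open>By reduction of leading monomials, for the multiset order on codes of the variables.\<close>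

theorem hilbert_basis:
  fixes S :: "'x::countable mpoly set"
  assumes V: "finite V" and S: "\<And>s. s \<in> S \<Longrightarrow> vars_in V s"
  shows "\<exists>T\<subseteq>S. finite T \<and> S \<subseteq> ideal_in V T"
proof -
  \<comment> \<open>The multiset order on \<open>nat multiset\<close> is a well-order compatible
    with addition, hence a monomial order. The code is injective, so leading monomials are
    unique.\<close>
  define \<kappa> :: "'x multiset \<Rightarrow> nat multiset" where "\<kappa> = image_mset to_nat"
  have \<kappa>_inj: "inj \<kappa>" unfolding \<kappa>_def by (rule multiset.inj_map) simp
  have \<kappa>_plus: "\<kappa> (m + m') = \<kappa> m + \<kappa> m'" for m m' by (simp add: \<kappa>_def)
  define lm where "lm f m \<longleftrightarrow> m \<in> supp f \<and> (\<forall>m'\<in>supp f. \<kappa> m' \<le> \<kappa> m)" for f m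
  have lm_ex: "\<exists>m. lm f m" if "f \<noteq> 0" for f
  proof -
    have "Max (\<kappa> ` supp f) \<in> \<kappa> ` supp f" using that by (intro Max_in) auto
    then obtain m where "m \<in> supp f" "\<kappa> m = Max (\<kappa> ` supp f)" by auto
    then show ?thesis by (auto simp: lm_def)
  qed
  define I where "I = ideal_in V S"
  have I_vars: "vars_in V f" if "f \<in> I" for f
    using that S unfolding I_def by (rule ideal_in_vars)
  define L where "L = {m. \<exists>f\<in>I. lm f m}"
  have "\<exists>L0\<subseteq>L. finite L0 \<and> (\<forall>m\<in>L. \<exists>m0\<in>L0. m0 \<subseteq># m)"
    using I_vars by (intro dickson[OF V]) (auto simp: L_def lm_def vars_in_def)
  then obtain L0 where L0: "L0 \<subseteq> L" "finite L0" "\<And>m. m \<in> L \<Longrightarrow> \<exists>m0\<in>L0. m0 \<subseteq># m" by blast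
  have "\<forall>m\<in>L0. \<exists>h. h \<in> I \<and> lm h m" using L0(1) by (auto simp: L_def)
  from bchoice[OF this] obtain g where g: "\<And>m. m \<in> L0 \<Longrightarrow> g m \<in> I \<and> lm (g m) m" by blast
  define J where "J = ideal_in V (g ` L0)"
  have reduce: "f \<in> J" if "f \<in> I" "\<forall>m\<in>supp f. \<kappa> m < w" for f w
    using that
  proof (induction w arbitrary: f rule: less_induct)
    case (less w)
    show ?case
    proof (cases "f = 0")
      case True
      then show ?thesis by (simp add: J_def ideal_in_def mp.span_zero)
    next
      case False
      then obtain m where m: "lm f m" using lm_ex by blast
      then have "m \<in> L" using less.prems(1) by (auto simp: L_def)
      then obtain m0 where m0: "m0 \<in> L0" "m0 \<subseteq># m" using L0(3) by blast
      note gm = g[OF m0(1)]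
      \<comment> \<open>\<open>q\<close> is the multiple of \<open>g m0\<close> with the same
        leading term as \<open>f\<close>, so that subtracting it lowers the leading
        monomial.\<close>
      define c where "c = coef f m / coef (g m0) m0"
      define q where "q = cmul c (mon (m - m0) 1 * g m0)"
      have mV: "set_mset (m - m0) \<subseteq> V"
        using m I_vars[OF less.prems(1)] by (auto simp: lm_def vars_in_def dest: in_diffD)
      have qI: "q \<in> I"
        unfolding q_def using gm mV ideal_in_mult[of "g m0" V S "m - m0"]
        by (simp add: I_def ideal_in_def mp.span_scale)
      have qJ: "q \<in> J"
        unfolding q_def using m0(1) mV ideal_in_mult[of "g m0" V "g ` L0" "m - m0"]
        by (simp add: J_def ideal_in_base) (simp add: ideal_in_def mp.span_scale)
      have "coef (g m0) m0 \<noteq> 0" using gm by (auto simp: lm_def in_keys_iff)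
      moreover have "m - (m - m0) = m0" using m0(2)
        by (metis add_diff_cancel_right' subset_mset.add_diff_inverse)
      ultimately have cancel: "coef q m = coef f m"
        using m0(2) by (simp add: q_def coef_monom_mult c_def)
      have small: "\<kappa> m' < \<kappa> m" if "m' \<in> supp (f - q)" for m'
      proof -
        have "m' \<noteq> m" using that cancel by (auto simp: in_keys_iff lookup_minus)
        have "m' \<in> supp f \<or> m' \<in> supp q" using that by (auto simp: in_keys_iff lookup_minus)
        then have "\<kappa> m' \<le> \<kappa> m"
        proof
          assume "m' \<in> supp q"
          then have "m' \<in> supp (mon (m - m0) 1 * g m0)"
            using keys_cmul_subset by (auto simp: q_def)
          then obtain m'' where m'': "m' = (m - m0) + m''" "m'' \<in> supp (g m0)"
            using keys_mult[of "mon (m - m0) 1" "g m0"] by auto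
          then have "\<kappa> m'' \<le> \<kappa> m0" using gm by (auto simp: lm_def)
          then have "\<kappa> m' \<le> \<kappa> (m - m0) + \<kappa> m0" by (simp add: m'' \<kappa>_plus)
          also have "\<dots> = \<kappa> m" using m0(2) by (simp flip: \<kappa>_plus)
          finally show ?thesis .
        qed (use m in \<open>auto simp: lm_def\<close>)
        with \<open>m' \<noteq> m\<close> show ?thesis using \<kappa>_inj by (auto simp: le_less dest: injD)
      qed
      have "f - q \<in> I" using less.prems(1) qI unfolding I_def ideal_in_def by (rule mp.span_diff)
      moreover have "\<kappa> m < w" using m less.prems(2) by (auto simp: lm_def)
      ultimately have "f - q \<in> J" using small less.IH by blast
      then have "(f - q) + q \<in> J" using qJ unfolding J_def ideal_in_def by (intro mp.span_add)
      then show ?thesis by simp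
    qed
  qed
  have "I \<subseteq> J"
  proof
    fix f assume f: "f \<in> I"
    show "f \<in> J"
    proof (cases "f = 0")
      case True
      then show ?thesis by (simp add: J_def ideal_in_def mp.span_zero)
    next
      case False
      then obtain m where m: "lm f m" using lm_ex by blast
      \<comment> \<open>Just a strict upper bound for the codes of all monomials of
        \<open>f\<close>, from which \<open>reduce\<close> can start.\<close>
      have "\<kappa> m' < add_mset 0 (\<kappa> m)" if "m' \<in> supp f" for m'
      proof -
        have "\<kappa> m' \<le> \<kappa> m" using m that by (auto simp: lm_def)
        also have "\<kappa> m < add_mset 0 (\<kappa> m)" by (rule le_multiset_right_total)
        finally show ?thesis .
      qed
      then show ?thesis using reduce f by blast
    qed
  qed
  \<comment> \<open>The \<open>g m\<close> lie in the ideal but perhaps not in \<open>S\<close>;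
    each of these finitely many elements involves finitely many members of \<open>S\<close>.\<close>
  have "\<forall>m\<in>L0. \<exists>T\<subseteq>S. finite T \<and> g m \<in> ideal_in V T"
    using g ideal_in_finite unfolding I_def by blast
  from bchoice[OF this]
  obtain T where T: "\<And>m. m \<in> L0 \<Longrightarrow> T m \<subseteq> S \<and> finite (T m) \<and> g m \<in> ideal_in V (T m)"
    by blast
  define U where "U = (\<Union>m\<in>L0. T m)"
  have "g m \<in> ideal_in V U" if "m \<in> L0" for m
    using T[OF that] ideal_in_mono[of "T m" U V] that by (auto simp: U_def)
  then have "J \<subseteq> ideal_in V U" unfolding J_def by (intro ideal_in_subset) auto
  moreover have "S \<subseteq> I" by (auto simp: I_def ideal_in_base)
  ultimately have "S \<subseteq> ideal_in V U" using \<open>I \<subseteq> J\<close> by blast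
  moreover have "U \<subseteq> S" "finite U" using T L0(2) by (auto simp: U_def)
  ultimately show ?thesis by blast
qed

section \<open>The action of matrices on polynomials\<close>

definition subst :: "('x \<Rightarrow> 'y mpoly) \<Rightarrow> 'x mpoly \<Rightarrow> 'y mpoly" where
  "subst \<sigma> P = (\<Sum>m\<in>supp P. cmul (coef P m) (prod_mset (image_mset \<sigma> m)))"

lemma subst_eq:
  assumes "finite A" "supp P \<subseteq> A"
  shows "subst \<sigma> P = (\<Sum>m\<in>A. cmul (coef P m) (prod_mset (image_mset \<sigma> m)))"
  unfolding subst_def using assms by (intro sum.mono_neutral_left) (auto simp: in_keys_iff)

lemma subst_add: "subst \<sigma> (P + Q) = subst \<sigma> P + subst \<sigma> Q"
proof -
  let ?A = "supp P \<union> supp Q"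
  have *: "subst \<sigma> h = (\<Sum>m\<in>?A. cmul (coef h m) (prod_mset (image_mset \<sigma> m)))"
    if "supp h \<subseteq> ?A" for h
    by (rule subst_eq) (use that in auto)
  show ?thesis
    by (subst (1 2 3) *) (auto simp: lookup_add mp.scale_left_distrib sum.distrib dest: keys_add[THEN subsetD])
qed

lemma subst_monom: "subst \<sigma> (mon m c) = cmul c (prod_mset (image_mset \<sigma> m))"
  by (subst subst_eq[of "{m}"]) auto

lemma subst_0 [simp]: "subst \<sigma> 0 = 0"
  by (simp add: subst_def)

lemma subst_cmul: "subst \<sigma> (cmul c P) = cmul c (subst \<sigma> P)"
  by (induction P rule: mpoly_induct) (auto simp: cmul_monom subst_monom subst_add mp.scale_right_distrib)

lemma subst_mult: "subst \<sigma> (P * Q) = subst \<sigma> P * subst \<sigma> Q"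
proof (induction P rule: mpoly_induct)
  case (monom m c)
  show ?case
    by (induction Q rule: mpoly_induct)
      (simp_all add: mult_single subst_monom subst_add distrib_left cmul_mult_left cmul_mult_right)
qed (simp add: distrib_right subst_add)

lemma subst_X: "subst \<sigma> (Var x) = \<sigma> x"
  by (simp add: subst_monom)

lemma subst_1: "subst \<sigma> (mon {#} c) = mon {#} c"
  by (simp add: subst_monom cmul_def)

lemma subst_sum: "subst \<sigma> (sum f A) = (\<Sum>a\<in>A. subst \<sigma> (f a))"
  by (induction A rule: infinite_finite_induct) (auto simp: subst_add)

lemma subst_comp: "subst \<sigma> (subst \<tau> P) = subst (\<lambda>x. subst \<sigma> (\<tau> x)) P"
proof (induction P rule: mpoly_induct)
  case (monom m c)
  have "subst \<sigma> (prod_mset (image_mset \<tau> m)) = prod_mset (image_mset (\<lambda>x. subst \<sigma> (\<tau> x)) m)"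
    by (induction m) (auto simp: subst_mult subst_1 simp flip: single_one)
  then show ?case by (simp add: subst_monom subst_cmul)
qed (simp add: subst_add)

lemma subst_id: "subst Var P = P"
proof (induction P rule: mpoly_induct)
  case (monom m c)
  have "prod_mset (image_mset Var m) = mon m 1"
    by (induction m) (auto simp: mult_single)
  then show ?case by (simp add: subst_monom cmul_monom)
qed (simp add: subst_add)

section \<open>Homogeneous components\<close>

definition homogeneous :: "nat \<Rightarrow> 'x mpoly \<Rightarrow> bool" where
  "homogeneous d P \<longleftrightarrow> (\<forall>m\<in>supp P. size m = d)"

definition hcomp :: "nat \<Rightarrow> 'x mpoly \<Rightarrow> 'x mpoly" where
  "hcomp d P = (\<Sum>m | m \<in> supp P \<and> size m = d. mon m (coef P m))"

lemma coef_hcomp: "coef (hcomp d P) m = (if size m = d then coef P m else 0)"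
proof -
  have "coef (hcomp d P) m = (\<Sum>k | k \<in> supp P \<and> size k = d. if k = m then coef P k else 0)"
    by (simp add: hcomp_def lookup_sum lookup_single when_def)
  also have "\<dots> = (if size m = d then coef P m else 0)"
    by (simp add: in_keys_iff)
  finally show ?thesis .
qed

lemma hcomp_add: "hcomp d (P + Q) = hcomp d P + hcomp d Q"
  by (rule poly_mapping_eqI) (simp add: coef_hcomp lookup_add)

lemma hcomp_cmul: "hcomp d (cmul c P) = cmul c (hcomp d P)"
  by (rule poly_mapping_eqI) (simp add: coef_hcomp)

lemma hcomp_0 [simp]: "hcomp d 0 = 0"
  by (rule poly_mapping_eqI) (simp add: coef_hcomp)

lemma hcomp_hom: "homogeneous k P \<Longrightarrow> hcomp d P = (if k = d then P else 0)"
  by (rule poly_mapping_eqI) (auto simp: coef_hcomp homogeneous_def in_keys_iff)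

lemma hom_hcomp: "homogeneous d (hcomp d P)"
  by (auto simp: homogeneous_def in_keys_iff coef_hcomp split: if_splits)

lemma supp_hcomp: "supp (hcomp d P) \<subseteq> supp P"
  by (auto simp: in_keys_iff coef_hcomp split: if_splits)

lemma sum_hcomp:
  assumes "deg_less d P"
  shows "(\<Sum>k<d. hcomp k P) = P"
proof (rule poly_mapping_eqI)
  fix m
  have "coef (\<Sum>k<d. hcomp k P) m = (\<Sum>k<d. if k = size m then coef P m else 0)"
    by (simp add: lookup_sum coef_hcomp eq_commute)
  also have "\<dots> = coef P m" using assms by (auto simp: deg_less_def in_keys_iff)
  finally show "coef (\<Sum>k<d. hcomp k P) m = coef P m" .
qed

lemma hom_mult: "homogeneous k P \<Longrightarrow> homogeneous l Q \<Longrightarrow> homogeneous (k + l) (P * Q)"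
  using keys_mult[of P Q] by (fastforce simp: homogeneous_def)

lemma hom_add: "homogeneous k P \<Longrightarrow> homogeneous k Q \<Longrightarrow> homogeneous k (P + Q)"
  using keys_add[of P Q] by (fastforce simp: homogeneous_def)

lemma hom_cmul: "homogeneous k P \<Longrightarrow> homogeneous k (cmul c P)"
  using keys_cmul_subset[of c P] by (fastforce simp: homogeneous_def)

lemma hom_0 [simp]: "homogeneous k 0"
  by (simp add: homogeneous_def)

lemma hom_monom: "homogeneous (size m) (mon m c)"
  by (auto simp: homogeneous_def)

lemma hom_X: "homogeneous 1 (Var x)"
  by (simp add: homogeneous_def)

lemma hom_sum: "(\<And>a. a \<in> A \<Longrightarrow> homogeneous k (f a)) \<Longrightarrow> homogeneous k (sum f A)"
  by (induction A rule: infinite_finite_induct) (auto simp: hom_add)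

text \<open>As in \<open>standard_action\<close>, the index of the variable selects a column of
  \<open>g\<close>. This makes \<open>act\<close> a left action, see \<open>act_comp\<close>; all
  copies are transformed alike.\<close>

definition act :: "complex ^ 'n ^ 'n \<Rightarrow> ('n::finite \<times> nat) mpoly \<Rightarrow> ('n \<times> nat) mpoly" where
  "act g = subst (\<lambda>x. \<Sum>j\<in>UNIV. cmul (g $ j $ fst x) (Var (j, snd x)))"

lemma act_simps:
  "act g (P + Q) = act g P + act g Q"
  "act g (cmul c P) = cmul c (act g P)"
  "act g (P * Q) = act g P * act g Q"
  "act g (sum f A) = (\<Sum>a\<in>A. act g (f a))"
  "act g (mon {#} c) = mon {#} c"
  "act g 0 = 0"
  by (simp_all add: act_def subst_add subst_cmul subst_mult subst_sum subst_1)

lemma act_X: "act g (Var (i, k)) = (\<Sum>j\<in>UNIV. cmul (g $ j $ i) (Var (j, k)))"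
  by (simp add: act_def subst_X)

lemma monom_add_mset: "mon (add_mset x m) 1 = Var x * mon m 1"
  by (simp add: mult_single)

lemma act_monom_hom: "homogeneous (size m) (act g (mon m 1))"
proof (induction m)
  case empty
  show ?case using hom_monom[of "{#}"] by (simp only: act_simps)
next
  case (add x m)
  have "homogeneous 1 (act g (Var x))"
    by (cases x) (auto simp: act_X simp del: One_nat_def intro!: hom_sum hom_cmul hom_X)
  with add show ?case
    unfolding monom_add_mset[of x m] act_simps using hom_mult[of 1 _ "size m"] by simp
qed

text \<open>Linear substitutions keep the degree. Hence the homogeneous components of an invariant
  are invariant.\<close>

lemma hcomp_act: "hcomp d (act g P) = act g (hcomp d P)"
proof (induction P rule: mpoly_induct)
  case (monom m c)
  show ?case
    by (subst (1 2) monom_eq_cmul)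
      (simp add: act_simps hcomp_cmul hcomp_hom[OF act_monom_hom] hcomp_hom[OF hom_monom])
qed (simp add: act_simps hcomp_add)

lemma supp_act_monom:
  assumes "m' \<in> supp (act g (mon m 1))"
  shows "size m' = size m" "snd ` set_mset m' \<subseteq> snd ` set_mset m"
proof -
  show "size m' = size m" using act_monom_hom[of m g] assms by (auto simp: homogeneous_def)
  show "snd ` set_mset m' \<subseteq> snd ` set_mset m"
    using assms
  proof (induction m arbitrary: m')
    case empty
    then show ?case by (simp only: act_simps) (auto split: if_splits)
  next
    case (add x m)
    from add.prems obtain a b where m': "m' = a + b" "a \<in> supp (act g (Var x))" "b \<in> supp (act g (mon m 1))"
      unfolding monom_add_mset[of x m] act_simps using keys_mult by blast
    obtain i k where x: "x = (i, k)" by (cases x)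
    have "coef (act g (Var x)) a \<noteq> 0" using m'(2) by (simp add: in_keys_iff)
    then have "(\<Sum>j\<in>UNIV. g $ j $ i * coef (Var (j, k)) a) \<noteq> 0"
      by (simp add: x act_X lookup_sum)
    then obtain j where "g $ j $ i * coef (Var (j, k)) a \<noteq> 0"
      by (rule sum.not_neutral_contains_not_neutral)
    then have "a = {#(j, k)#}" by (auto simp: lookup_single when_def split: if_splits)
    then show ?case using m' add.IH[OF m'(3)] x by auto
  qed
qed

lemma act_comp:
  fixes g h :: "complex ^ 'n::finite ^ 'n"
  shows "act (g ** h) P = act g (act h P)"
proof -
  have "(\<Sum>j\<in>UNIV. cmul ((g ** h) $ j $ fst x) (Var (j, snd x))) =
      subst (\<lambda>x. \<Sum>j\<in>UNIV. cmul (g $ j $ fst x) (Var (j, snd x))) (\<Sum>j\<in>UNIV. cmul (h $ j $ fst x) (Var (j, snd x)))"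
    for x :: "'n \<times> nat"
  proof -
    have "subst (\<lambda>x. \<Sum>j\<in>UNIV. cmul (g $ j $ fst x) (Var (j, snd x))) (\<Sum>j\<in>UNIV. cmul (h $ j $ fst x) (Var (j, snd x)))
      = (\<Sum>l\<in>UNIV. \<Sum>j\<in>UNIV. cmul (g $ j $ l * h $ l $ fst x) (Var (j, snd x)))"
      by (simp add: subst_sum subst_cmul subst_X mp.scale_sum_right algebra_simps)
    also have "\<dots> = (\<Sum>j\<in>UNIV. \<Sum>l\<in>UNIV. cmul (g $ j $ l * h $ l $ fst x) (Var (j, snd x)))"
      by (rule sum.swap)
    also have "\<dots> = (\<Sum>j\<in>UNIV. cmul ((g ** h) $ j $ fst x) (Var (j, snd x)))"
      by (simp add: matrix_matrix_mult_def mp.scale_sum_left)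
    finally show ?thesis by simp
  qed
  then show ?thesis by (simp only: act_def subst_comp)
qed

lemma act_id: "act (Finite_Cartesian_Product.mat 1) P = P"
proof -
  have "(\<Sum>j\<in>UNIV. cmul ((Finite_Cartesian_Product.mat 1 :: complex ^ 'a ^ 'a) $ j $ fst x) (Var (j, snd x))) = Var x"
    for x :: "'a \<times> nat"
  proof -
    have "(\<Sum>j\<in>UNIV. cmul ((Finite_Cartesian_Product.mat 1 :: complex ^ 'a ^ 'a) $ j $ fst x) (Var (j, snd x))) =
      (\<Sum>j\<in>UNIV. if j = fst x then Var (j, snd x) else 0)"
      by (intro sum.cong) (auto simp: Finite_Cartesian_Product.mat_def)
    then show ?thesis by simp
  qed
  then show ?thesis by (simp add: act_def subst_id)
qed

lemma polynomial_on_matrices_sum: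
  "(\<And>a. a \<in> A \<Longrightarrow> polynomial_on_matrices (f a)) \<Longrightarrow> polynomial_on_matrices (\<lambda>g. \<Sum>a\<in>A. f a g)"
  by (induction A rule: infinite_finite_induct)
    (auto intro: polynomial_on_matrices.const polynomial_on_matrices.add)

text \<open>These are the matrix entries of the action on polynomials of a fixed degree; that they
  are polynomials in \<open>g\<close> makes this representation rational.\<close>

lemma polynomial_on_matrices_coef_act: "polynomial_on_matrices (\<lambda>g. coef (act g (mon m 1)) m')"
proof (induction m arbitrary: m')
  case empty
  show ?case by (simp only: act_simps) (rule polynomial_on_matrices.const)
next
  case (add x m)
  obtain i k where x: "x = (i, k)" by (cases x)
  have "act g (mon (add_mset x m) 1) = (\<Sum>j\<in>UNIV. cmul (g $ j $ i) (Var (j, k) * act g (mon m 1)))" for g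
    unfolding x monom_add_mset[of "(i, k)" m] act_simps(3) act_X sum_distrib_right cmul_mult_left ..
  then have "coef (act g (mon (add_mset x m) 1)) m' =
      (\<Sum>j\<in>UNIV. g $ j $ i * (if (j, k) \<in># m' then coef (act g (mon m 1)) (m' - {#(j, k)#}) else 0))" for g
    by (simp only: lookup_sum coef_cmul coef_X_mult)
  moreover have "polynomial_on_matrices (\<lambda>g. \<Sum>j\<in>UNIV. g $ j $ i *
      (if (j, k) \<in># m' then coef (act g (mon m 1)) (m' - {#(j, k)#}) else 0))"
  proof (rule polynomial_on_matrices_sum)
    fix j
    show "polynomial_on_matrices (\<lambda>g. g $ j $ i * (if (j, k) \<in># m' then coef (act g (mon m 1)) (m' - {#(j, k)#}) else 0))"
    proof (cases "(j, k) \<in># m'")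
      case True
      have "polynomial_on_matrices (\<lambda>g. g $ j $ i * coef (act g (mon m 1)) (m' - {#(j, k)#}))"
        by (intro polynomial_on_matrices.mult polynomial_on_matrices.entry add)
      with True show ?thesis by simp
    next
      case False
      with polynomial_on_matrices.const[of 0] show ?thesis by simp
    qed
  qed
  ultimately show ?case by simp
qed

section \<open>Invariants of reductive groups\<close>

text \<open>The coefficients are indexed by \<open>I\<close> rather than by the image, since
  \<open>b\<close> need not be injective.\<close>

lemma mem_span_image_iff_sum:
  assumes "finite I" "w \<in> mp.span (b ` I)"
  shows "\<exists>c. w = (\<Sum>i\<in>I. cmul (c i) (b i))"
  using assms(2)
proof (induction rule: mp.span_induct_alt)
  case base
  show ?case by (intro exI[of _ "\<lambda>_. 0"]) simp
next
  case (step a x y)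
  then obtain i c where i: "x = b i" "i \<in> I" and c: "y = (\<Sum>i\<in>I. cmul (c i) (b i))" by auto
  have "cmul a x = (\<Sum>j\<in>I. cmul (if j = i then a else 0) (b j))"
    using i assms(1) by (simp add: if_distrib[of "\<lambda>c. cmul c _"] cong: if_cong)
  then have "cmul a x + y = (\<Sum>j\<in>I. cmul ((if j = i then a else 0) + c j) (b j))"
    unfolding c by (simp only: mp.scale_left_distrib sum.distrib)
  then show ?case by (intro exI[of _ "\<lambda>j. (if j = i then a else 0) + c j"])
qed

text \<open>This replaces the Reynolds operator: a vector lifting \<open>w\<close> in an invariant complement of the kernel of
  \<open>c \<mapsto> \<Sum>\<^sub>i c\<^sub>i b\<^sub>i\<close> is fixed by \<open>G\<close>.\<close>

lemma reductive_lift: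
  fixes G :: "(complex ^ 'n::finite ^ 'n) set" and b :: "'i \<Rightarrow> 'x mpoly"
  assumes G: "reductive_group G" and I: "finite I"
    and A_poly: "\<And>i j. i \<in> I \<Longrightarrow> j \<in> I \<Longrightarrow> polynomial_on_matrices (\<lambda>g. A g i j)"
    and A_one: "\<And>i j. i \<in> I \<Longrightarrow> j \<in> I \<Longrightarrow> A (Finite_Cartesian_Product.mat 1) i j = (if i = j then 1 else 0)"
    and A_mult: "\<And>g h i j. g \<in> G \<Longrightarrow> h \<in> G \<Longrightarrow> i \<in> I \<Longrightarrow> j \<in> I \<Longrightarrow>
        A (g ** h) i j = (\<Sum>k\<in>I. A g i k * A h k j)"
    and \<tau>_lin: "\<And>g P Q. \<tau> g (P + Q) = \<tau> g P + \<tau> g Q" "\<And>g c P. \<tau> g (cmul c P) = cmul c (\<tau> g P)"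
    and \<tau>_b: "\<And>g j. g \<in> G \<Longrightarrow> j \<in> I \<Longrightarrow> \<tau> g (b j) = (\<Sum>i\<in>I. cmul (A g i j) (b i))"
    and w: "w \<in> mp.span (b ` I)" "\<And>g. g \<in> G \<Longrightarrow> \<tau> g w = w"
  shows "\<exists>c. w = (\<Sum>i\<in>I. cmul (c i) (b i)) \<and> (\<forall>g\<in>G. \<forall>i\<in>I. (\<Sum>j\<in>I. A g i j * c j) = c i)"
proof -
  have \<tau>_0: "\<tau> g 0 = 0" for g using \<tau>_lin(2)[of g 0 0] by simp
  have \<tau>_sum: "\<tau> g (sum f J) = (\<Sum>a\<in>J. \<tau> g (f a))" for g and f :: "nat \<Rightarrow> 'x mpoly" and J
    by (induction J rule: infinite_finite_induct) (auto simp: \<tau>_lin \<tau>_0)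
  define d where "d = card I"
  obtain e where e: "bij_betw e {0..<d} I"
    using ex_bij_betw_nat_finite[OF I] by (auto simp: d_def)
  then have eI: "e i \<in> I" if "i < d" for i using that by (auto simp: bij_betw_def)
  have e_eq: "e i = e j \<longleftrightarrow> i = j" if "i < d" "j < d" for i j
    using e that by (auto simp: bij_betw_def inj_on_def)
  have reindex: "(\<Sum>i\<in>I. f i) = (\<Sum>i=0..<d. f (e i))" for f :: "'i \<Rightarrow> 'z::comm_monoid_add"
    by (rule sum.reindex_bij_betw[OF e, symmetric])
  \<comment> \<open>The representation is on coefficient vectors and not on the span of the
    \<open>b i\<close>: these may be dependent, and it is the coefficients that are to become
    invariant.\<close>
  define \<pi> where "\<pi> g = Matrix.mat d d (\<lambda>(i, j). A g (e i) (e j))" for g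
  have \<pi>_vec: "vec_index (\<pi> g *\<^sub>v v) i = (\<Sum>j=0..<d. A g (e i) (e j) * vec_index v j)"
    if "i < d" "v \<in> carrier_vec d" for g v i
    using that by (auto simp: \<pi>_def scalar_prod_def intro!: sum.cong)
  have \<pi>_carrier: "\<pi> g \<in> carrier_mat d d" for g by (simp add: \<pi>_def)
  have "rational_representation G d \<pi>"
    unfolding rational_representation_def
  proof (intro conjI ballI allI impI)
    show "\<pi> (Finite_Cartesian_Product.mat 1) = 1\<^sub>m d"
      by (rule eq_matI) (auto simp: \<pi>_def A_one eI e_eq)
  next
    fix g h assume "g \<in> G" "h \<in> G"
    then show "\<pi> (g ** h) = \<pi> g * \<pi> h"
      by (intro eq_matI) (auto simp: \<pi>_def A_mult eI scalar_prod_def reindex intro!: sum.cong)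
  next
    fix i j assume "i < d" "j < d"
    then show "regular_function_on G (\<lambda>g. \<pi> g $$ (i, j))"
      unfolding regular_function_on_def
      by (intro exI[of _ "\<lambda>g. A g (e i) (e j)"] exI[of _ 0]) (auto simp: \<pi>_def A_poly eI)
  qed (rule \<pi>_carrier)
  then have cr: "completely_reducible G d \<pi>"
    using G by (auto simp: reductive_group_def)
  define \<phi> where "\<phi> v = (\<Sum>i=0..<d. cmul (vec_index v i) (b (e i)))" for v
  have \<phi>_add: "\<phi> (v + v') = \<phi> v + \<phi> v'" if "v \<in> carrier_vec d" "v' \<in> carrier_vec d" for v v'
    using that by (simp add: \<phi>_def mp.scale_left_distrib sum.distrib)
  have \<phi>_smult: "\<phi> (a \<cdot>\<^sub>v v) = cmul a (\<phi> v)" if "v \<in> carrier_vec d" for a v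
    using that by (simp add: \<phi>_def mp.scale_sum_right)
  have \<phi>_\<pi>: "\<phi> (\<pi> g *\<^sub>v v) = \<tau> g (\<phi> v)" if "g \<in> G" "v \<in> carrier_vec d" for g v
  proof -
    have "\<phi> (\<pi> g *\<^sub>v v) = (\<Sum>i=0..<d. \<Sum>j=0..<d. cmul (A g (e i) (e j) * vec_index v j) (b (e i)))"
      unfolding \<phi>_def using that(2) by (intro sum.cong) (simp_all add: \<pi>_vec mp.scale_sum_left)
    also have "\<dots> = (\<Sum>j=0..<d. \<Sum>i=0..<d. cmul (A g (e i) (e j) * vec_index v j) (b (e i)))"
      by (rule sum.swap)
    also have "\<dots> = (\<Sum>j=0..<d. cmul (vec_index v j) (\<tau> g (b (e j))))"
      using that(1) by (intro sum.cong) (simp_all add: \<tau>_b eI reindex mp.scale_sum_right mult.commute)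
    also have "\<dots> = \<tau> g (\<phi> v)" by (simp add: \<phi>_def \<tau>_sum \<tau>_lin)
    finally show ?thesis .
  qed
  have \<pi>_v_carrier: "\<pi> g *\<^sub>v v \<in> carrier_vec d" for g v
    by (rule carrier_vecI) (simp add: \<pi>_def)
  define K where "K = {v \<in> carrier_vec d. \<phi> v = 0}"
  have "invariant_subspace G d \<pi> K"
    unfolding invariant_subspace_def K_def
    by (auto simp: \<phi>_add \<phi>_smult \<phi>_\<pi> \<tau>_0 \<pi>_v_carrier) (simp add: \<phi>_def)
  then obtain U where U: "invariant_subspace G d \<pi> U" "K \<inter> U = {0\<^sub>v d}"
    and KU: "\<And>v. v \<in> carrier_vec d \<Longrightarrow> \<exists>k\<in>K. \<exists>u\<in>U. v = k + u"
    using cr unfolding completely_reducible_def by metis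
  obtain c0 where c0: "w = (\<Sum>i\<in>I. cmul (c0 i) (b i))"
    using mem_span_image_iff_sum[OF I w(1)] by blast
  obtain k u where ku: "k \<in> K" "u \<in> U" "Matrix.vec d (\<lambda>i. c0 (e i)) = k + u"
    using KU[of "Matrix.vec d (\<lambda>i. c0 (e i))"] by auto
  have uc: "u \<in> carrier_vec d" using U(1) ku(2) by (auto simp: invariant_subspace_def)
  have kc: "k \<in> carrier_vec d" "\<phi> k = 0" using ku(1) by (auto simp: K_def)
  have "\<phi> (k + u) = w"
    unfolding ku(3)[symmetric] c0 by (simp add: \<phi>_def reindex)
  then have \<phi>u: "\<phi> u = w" using kc uc by (simp add: \<phi>_add)
  have fixed: "\<pi> g *\<^sub>v u = u" if g: "g \<in> G" for g
  proof -
    \<comment> \<open>The difference of \<open>u\<close> and its image lies in \<open>U\<close>, and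
      also in the kernel \<open>K\<close>, since both are lifts of the fixed vector
      \<open>w\<close>.\<close>
    let ?u = "\<pi> g *\<^sub>v u + (- 1) \<cdot>\<^sub>v u"
    have "\<pi> g *\<^sub>v u \<in> U" "(- 1) \<cdot>\<^sub>v u \<in> U" using U(1) ku(2) g by (auto simp: invariant_subspace_def)
    then have "?u \<in> U" using U(1) by (auto simp: invariant_subspace_def)
    moreover have "\<phi> ?u = 0"
      using uc g \<pi>_v_carrier by (simp add: \<phi>_add \<phi>_smult \<phi>_\<pi> \<phi>u w(2))
    then have "?u \<in> K" using uc \<pi>_v_carrier by (auto simp: K_def)
    ultimately have zero: "?u = 0\<^sub>v d" using U(2) by blast
    show ?thesis
    proof (rule eq_vecI)
      fix i assume "i < dim_vec u"
      then have i: "i < d" using uc by simp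
      then have "vec_index ?u i = 0" by (simp add: zero)
      then show "vec_index (\<pi> g *\<^sub>v u) i = vec_index u i" using i uc \<pi>_v_carrier[of g u]
        by simp
    qed (use uc \<pi>_carrier[of g] in simp)
  qed
  define c where "c i = vec_index u (the_inv_into {0..<d} e i)" for i
  have ce: "c (e i) = vec_index u i" if "i < d" for i
    using e that by (simp add: c_def bij_betw_def the_inv_into_f_f)
  have "w = (\<Sum>i\<in>I. cmul (c i) (b i))"
    unfolding reindex \<phi>u[symmetric] \<phi>_def by (intro sum.cong) (simp_all add: ce)
  moreover have "(\<Sum>j\<in>I. A g i j * c j) = c i" if g: "g \<in> G" and "i \<in> I" for g i
  proof -
    obtain i' where i': "i = e i'" "i' < d" using e \<open>i \<in> I\<close> by (auto simp: bij_betw_def)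
    have "(\<Sum>j\<in>I. A g i j * c j) = vec_index (\<pi> g *\<^sub>v u) i'"
      using i' uc by (simp add: \<pi>_vec reindex ce)
    then show ?thesis using fixed[OF g] i' by (simp add: ce)
  qed
  ultimately show ?thesis by blast
qed

text \<open>Hilbert's argument is stopped before the conclusion that \<open>T\<close> generates the
  ring of invariants: in the vertex algebra products acquire lower terms, so the induction on the
  degree is carried out there. For this the degrees of the coefficients \<open>h t\<close> are
  recorded.\<close>

theorem hilbert_invariants:
  fixes G :: "(complex ^ 'n::finite ^ 'n) set"
  assumes G: "reductive_group G"
  defines "Inv \<equiv> {P. \<forall>g\<in>G. act g P = P}"
  shows "\<exists>T dg. finite T \<and> (\<forall>t\<in>T. t \<in> Inv \<and> homogeneous (dg t) t \<and> 1 \<le> dg t) \<and>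
    (\<forall>P d. P \<in> Inv \<longrightarrow> homogeneous d P \<longrightarrow> 1 \<le> d \<longrightarrow> vars_in (UNIV \<times> {..<N}) P \<longrightarrow>
      (\<exists>h. P = (\<Sum>t\<in>T. h t * t) \<and>
        (\<forall>t\<in>T. h t \<in> Inv \<and> (h t = 0 \<or> (\<exists>k. k + dg t = d \<and> homogeneous k (h t))))))"
proof -
  define V :: "('n \<times> nat) set" where "V = UNIV \<times> {..<N}"
  have V: "finite V" by (simp add: V_def)
  \<comment> \<open>Constants are excluded: they would generate the unit ideal, and a generator of
    degree 0 would leave coefficients of the same degree as \<open>P\<close>.\<close>
  define S where "S = {P \<in> Inv. vars_in V P \<and> (\<exists>d\<ge>1. homogeneous d P)}"
  obtain T where T: "T \<subseteq> S" "finite T" "S \<subseteq> ideal_in V T"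
    using hilbert_basis[OF V, of S] by (auto simp: S_def)
  have "\<forall>t\<in>T. \<exists>d. homogeneous d t \<and> 1 \<le> d" using T(1) by (auto simp: S_def)
  from bchoice[OF this] obtain dg where dg: "\<And>t. t \<in> T \<Longrightarrow> homogeneous (dg t) t \<and> 1 \<le> dg t" by blast
  have TInv: "act g t = t" if "t \<in> T" "g \<in> G" for g t
    using T(1) that by (auto simp: S_def Inv_def)
  define M :: "nat \<Rightarrow> ('n \<times> nat) multiset set" where "M k = {m. set_mset m \<subseteq> V \<and> size m = k}" for k
  have finM: "finite (M k)" for k
    by (rule finite_subset[OF _ finite_multisets_bounded[OF V, of k]]) (auto simp: M_def)
  have expand: "act g (mon m' 1) = (\<Sum>m\<in>M k. cmul (coef (act g (mon m' 1)) m) (mon m 1))"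
    if "m' \<in> M k" for g m' k
  proof -
    have "supp (act g (mon m' 1)) \<subseteq> M k"
    proof
      fix m assume "m \<in> supp (act g (mon m' 1))"
      from supp_act_monom[OF this] that show "m \<in> M k"
        by (fastforce simp: M_def V_def image_iff subset_iff)
    qed
    then have "(\<Sum>m\<in>supp (act g (mon m' 1)). mon m (coef (act g (mon m' 1)) m)) =
        (\<Sum>m\<in>M k. mon m (coef (act g (mon m' 1)) m))"
      using finM by (intro sum.mono_neutral_left) (auto simp: in_keys_iff)
    then show ?thesis using mpoly_sum_monom[of "act g (mon m' 1)"] by (simp add: cmul_monom)
  qed
  have "\<exists>h. P = (\<Sum>t\<in>T. h t * t) \<and>
        (\<forall>t\<in>T. h t \<in> Inv \<and> (h t = 0 \<or> (\<exists>k. k + dg t = d \<and> homogeneous k (h t))))"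
    if P: "P \<in> Inv" "homogeneous d P" "1 \<le> d" "vars_in V P" for P d
  proof -
    \<comment> \<open>For generators of degree above \<open>d\<close> the truncated difference
      \<open>d - dg t\<close> would be 0 and admit spurious terms.\<close>
    define T' where "T' = {t \<in> T. dg t \<le> d}"
    have finT': "finite T'" and T'T: "T' \<subseteq> T" using T(2) by (auto simp: T'_def)
    define I where "I = Sigma T' (\<lambda>t. M (d - dg t))"
    have finI: "finite I" using finT' finM by (auto simp: I_def)
    have sumI: "(\<Sum>i\<in>I. f i) = (\<Sum>t\<in>T'. \<Sum>m\<in>M (d - dg t). f (t, m))"
      for f :: "_ \<Rightarrow> 'z::comm_monoid_add"
      unfolding I_def using finT' finM by (subst sum.Sigma) auto
    define b :: "('n \<times> nat) mpoly \<times> ('n \<times> nat) multiset \<Rightarrow> ('n \<times> nat) mpoly"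
      where "b = (\<lambda>(t, m). mon m 1 * t)"
    \<comment> \<open>Block diagonal: each \<open>t\<close> is invariant, so \<open>G\<close> moves
      only the monomial in the product \<open>b (t, m)\<close>.\<close>
    define A :: "complex ^ 'n ^ 'n \<Rightarrow> ('n \<times> nat) mpoly \<times> ('n \<times> nat) multiset \<Rightarrow>
        ('n \<times> nat) mpoly \<times> ('n \<times> nat) multiset \<Rightarrow> complex"
      where "A g = (\<lambda>(t, m) (t', m'). if t = t' then coef (act g (mon m' 1)) m else 0)" for g
    have hcomp_span: "hcomp d f \<in> mp.span (b ` I)" if "f \<in> ideal_in V T" for f
      using that unfolding ideal_in_def
    proof (induction rule: mp.span_induct_alt)
      case base
      show ?case by (simp add: mp.span_zero)
    next
      case (step c x y)
      then obtain m t where x: "x = mon m 1 * t" "set_mset m \<subseteq> V" "t \<in> T" by blast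
      have "homogeneous (size m + dg t) x" unfolding x(1) using dg[OF x(3)] by (intro hom_mult hom_monom) auto
      then have "hcomp d x = (if size m + dg t = d then x else 0)" by (rule hcomp_hom)
      moreover have "x \<in> b ` I" if "size m + dg t = d"
        using x that by (intro image_eqI[of _ _ "(t, m)"]) (auto simp: b_def I_def T'_def M_def)
      ultimately have "hcomp d x \<in> mp.span (b ` I)"
        by (auto intro: mp.span_base mp.span_zero)
      with step show ?case by (simp add: hcomp_add hcomp_cmul mp.span_add mp.span_scale)
    qed
    have "P \<in> S" using P by (auto simp: S_def)
    then have "hcomp d P \<in> mp.span (b ` I)" using T(3) hcomp_span by blast
    then have P_span: "P \<in> mp.span (b ` I)" using P(2) by (simp add: hcomp_hom)
    have "\<exists>c. P = (\<Sum>i\<in>I. cmul (c i) (b i)) \<and> (\<forall>g\<in>G. \<forall>i\<in>I. (\<Sum>j\<in>I. A g i j * c j) = c i)"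
    proof (rule reductive_lift[OF G finI, where \<tau> = act])
      fix i j assume "i \<in> I" "j \<in> I"
      show "polynomial_on_matrices (\<lambda>g. A g i j)"
        by (cases i; cases j; cases "fst i = fst j")
          (simp_all add: A_def polynomial_on_matrices_coef_act polynomial_on_matrices.const)
      show "A (Finite_Cartesian_Product.mat 1) i j = (if i = j then 1 else 0)"
        by (cases i; cases j) (auto simp: A_def act_id lookup_single)
    next
      fix g h i j assume gh: "g \<in> G" "h \<in> G" and ij: "i \<in> I" "j \<in> I"
      obtain t m t' m' where i: "i = (t, m)" and j: "j = (t', m')" by (cases i; cases j)
      have t: "t \<in> T'" and m': "m' \<in> M (d - dg t')" using ij by (auto simp: i j I_def)
      have "(\<Sum>k\<in>I. A g i k * A h k j) =
        (\<Sum>s\<in>T'. if s = t then (\<Sum>m''\<in>M (d - dg t). A g i (t, m'') * A h (t, m'') j) else 0)"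
        unfolding sumI by (intro sum.cong) (auto simp: A_def i)
      also have "\<dots> = (\<Sum>m''\<in>M (d - dg t). A g i (t, m'') * A h (t, m'') j)"
        using t finT' by simp
      also have "\<dots> = A (g ** h) i j"
      proof (cases "t = t'")
        case True
        have "coef (act (g ** h) (mon m' 1)) m =
          coef (act g (\<Sum>m''\<in>M (d - dg t). cmul (coef (act h (mon m' 1)) m'') (mon m'' 1))) m"
          using expand[of m' "d - dg t" h] m' True by (simp add: act_comp)
        also have "\<dots> = (\<Sum>m''\<in>M (d - dg t). coef (act g (mon m'' 1)) m * coef (act h (mon m' 1)) m'')"
          by (simp add: act_simps lookup_sum mult.commute)
        finally show ?thesis using True by (simp add: A_def i j)
      next
        case False
        then show ?thesis by (simp add: A_def i j)
      qed
      finally show "A (g ** h) i j = (\<Sum>k\<in>I. A g i k * A h k j)" ..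
    next
      fix g j assume g: "g \<in> G" and "j \<in> I"
      then obtain t m' where j: "j = (t, m')" "t \<in> T'" "m' \<in> M (d - dg t)" by (auto simp: I_def)
      have "act g (b j) = act g (mon m' 1) * t"
        using TInv[of t g] j(2) T'T g by (auto simp: b_def j(1) act_simps)
      also have "\<dots> = (\<Sum>m\<in>M (d - dg t). cmul (coef (act g (mon m' 1)) m) (mon m 1)) * t"
        using expand[OF j(3), of g] by simp
      also have "\<dots> = (\<Sum>m\<in>M (d - dg t). cmul (A g (t, m) j) (b (t, m)))"
        by (simp add: sum_distrib_right cmul_mult_left A_def b_def j(1))
      also have "\<dots> = (\<Sum>s\<in>T'. if s = t then (\<Sum>m\<in>M (d - dg t). cmul (A g (t, m) j) (b (t, m))) else 0)"
        using j(2) finT' by simp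
      also have "\<dots> = (\<Sum>i\<in>I. cmul (A g i j) (b i))"
        unfolding sumI by (intro sum.cong) (auto simp: A_def j(1))
      finally show "act g (b j) = (\<Sum>i\<in>I. cmul (A g i j) (b i))" .
    qed (use P_span P(1) in \<open>auto simp: act_simps Inv_def\<close>)
    then obtain c where c: "P = (\<Sum>i\<in>I. cmul (c i) (b i))"
      and c_fixed: "\<And>g i. g \<in> G \<Longrightarrow> i \<in> I \<Longrightarrow> (\<Sum>j\<in>I. A g i j * c j) = c i" by blast
    \<comment> \<open>The coefficients that belong to \<open>t\<close> are assembled into one
      polynomial; it is invariant because its block of the coefficient vector is fixed.\<close>
    define h where "h t = (if t \<in> T' then \<Sum>m\<in>M (d - dg t). cmul (c (t, m)) (mon m 1) else 0)" for t
    have "(\<Sum>t\<in>T. h t * t) = (\<Sum>t\<in>T'. h t * t)"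
      using T(2) T'T by (intro sum.mono_neutral_right) (auto simp: h_def)
    also have "\<dots> = P"
      unfolding c sumI by (intro sum.cong) (auto simp: h_def b_def sum_distrib_right cmul_mult_left)
    finally have "P = (\<Sum>t\<in>T. h t * t)" ..
    moreover have "h t \<in> Inv" for t
    proof -
      have "act g (h t) = h t" if g: "g \<in> G" and t: "t \<in> T'" for g
      proof -
        let ?M = "M (d - dg t)"
        have fixed: "(\<Sum>m'\<in>?M. coef (act g (mon m' 1)) m * c (t, m')) = c (t, m)" if "m \<in> ?M" for m
        proof -
          have "c (t, m) = (\<Sum>j\<in>I. A g (t, m) j * c j)"
            using c_fixed[OF g, of "(t, m)"] t that by (simp add: I_def)
          also have "\<dots> = (\<Sum>s\<in>T'. if s = t then (\<Sum>m'\<in>?M. coef (act g (mon m' 1)) m * c (t, m')) else 0)"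
            unfolding sumI by (intro sum.cong) (auto simp: A_def)
          finally show ?thesis using t finT' by simp
        qed
        have "act g (h t) = (\<Sum>m'\<in>?M. cmul (c (t, m')) (act g (mon m' 1)))"
          using t by (simp add: h_def act_simps)
        also have "\<dots> = (\<Sum>m'\<in>?M. \<Sum>m\<in>?M. cmul (coef (act g (mon m' 1)) m * c (t, m')) (mon m 1))"
          by (intro sum.cong refl, subst expand) (auto simp: mp.scale_sum_right mult.commute)
        also have "\<dots> = (\<Sum>m\<in>?M. \<Sum>m'\<in>?M. cmul (coef (act g (mon m' 1)) m * c (t, m')) (mon m 1))"
          by (rule sum.swap)
        also have "\<dots> = (\<Sum>m\<in>?M. cmul (c (t, m)) (mon m 1))"
          by (intro sum.cong refl) (simp add: fixed flip: mp.scale_sum_left)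
        finally show ?thesis using t by (simp add: h_def)
      qed
      moreover have "act g (h t) = h t" if "t \<notin> T'" for g using that by (simp add: h_def act_simps)
      ultimately show ?thesis by (auto simp: Inv_def)
    qed
    moreover have "h t = 0 \<or> (\<exists>k. k + dg t = d \<and> homogeneous k (h t))" for t
    proof (cases "t \<in> T'")
      case True
      have "homogeneous (d - dg t) (\<Sum>m\<in>M (d - dg t). cmul (c (t, m)) (mon m 1))"
        by (intro hom_sum hom_cmul) (auto simp: M_def homogeneous_def)
      then have "homogeneous (d - dg t) (h t)" using True by (simp add: h_def)
      moreover have "(d - dg t) + dg t = d" using True by (simp add: T'_def)
      ultimately show ?thesis by blast
    qed (simp add: h_def)
    ultimately show ?thesis by blast
  qed
  moreover have "\<forall>t\<in>T. t \<in> Inv \<and> homogeneous (dg t) t \<and> 1 \<le> dg t" using T(1) dg by (auto simp: S_def)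
  ultimately show ?thesis using T(2) unfolding V_def by blast
qed

section \<open>Vertex algebras\<close>

context vertex_algebra
begin

lemma prd_simps:
  "prd k (a + a') b = prd k a b + prd k a' b"
  "prd k a (b + b') = prd k a b + prd k a b'"
  "prd k (scale c a) b = scale c (prd k a b)"
  "prd k a (scale c b) = scale c (prd k a b)"
  using prd_linear_left[of k b] prd_linear_right[of k a]
  by (auto simp: Vector_Spaces.linear_iff)

lemma prd_zero [simp]: "prd k 0 b = 0" "prd k a 0 = 0"
  using prd_simps(3)[of k 0 0 b] prd_simps(4)[of k a 0 0] by simp_all

lemma prd_diff: "prd k a (b - b') = prd k a b - prd k a b'" "prd k (a - a') b = prd k a b - prd k a' b"
  by (simp_all add: eq_diff_eq flip: prd_simps)

lemma prd_sum:
  "prd k (sum f A) b = (\<Sum>a\<in>A. prd k (f a) b)"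
  "prd k a (sum f A) = (\<Sum>i\<in>A. prd k a (f i))"
  by (induction A rule: infinite_finite_induct) (auto simp: prd_simps)

text \<open>If an upper index of the Borcherds identity is 0, one of its sums collapses to the first
  term; this yields the iterate and the commutator formula.\<close>

lemma sum_zero_gchoose:
  assumes "0 < N"
  shows "(\<Sum>j<N. scale (c j * (of_int 0 gchoose j)) (f j)) = scale (c 0) (f 0)"
proof -
  have "c j * (of_int 0 gchoose j) = (if j = 0 then c 0 else 0)" for j
    by (cases j) simp_all
  then have "(\<Sum>j<N. scale (c j * (of_int 0 gchoose j)) (f j)) = (\<Sum>j<N. if j = 0 then scale (c 0) (f 0) else 0)"
    by (intro sum.cong) auto
  then show ?thesis using assms by simp
qed

lemma iterate:
  "\<forall>\<^sub>F N in sequentially. prd k (prd n a b) c =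
    (\<Sum>j<N. scale ((- 1) ^ j * (of_int n gchoose j))
      (prd (n - int j) a (prd (k + int j) b c) - scale ((- 1) powi n) (prd (n + k - int j) b (prd (int j) a c))))"
  using borcherds[of 0 k n a b c] eventually_gt_at_top[of "0::nat"]
proof eventually_elim
  case (elim N)
  then show ?case
    using sum_zero_gchoose[of N "\<lambda>_. 1" "\<lambda>j. prd (k - int j) (prd (n + int j) a b) c"] by simp
qed

lemma commutator:
  "\<forall>\<^sub>F N in sequentially. prd m a (prd k b c) - prd k b (prd m a c) =
    (\<Sum>j<N. scale (of_int m gchoose j) (prd (m + k - int j) (prd (int j) a b) c))"
  using borcherds[of m k 0 a b c] eventually_gt_at_top[of "0::nat"]
proof eventually_elim
  case (elim N)
  then show ?case
    using sum_zero_gchoose[of N "\<lambda>j. (- 1) ^ j" "\<lambda>j. prd (m - int j) a (prd (k + int j) b c) - prd (k - int j) b (prd (m + int j) a c)"]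
    by simp
qed

lemma gchoose_minus: "p \<ge> 1 \<Longrightarrow> (- 1) ^ j * (of_int (- int p) gchoose j) = (of_nat ((p + j - 1) choose j) :: complex)"
  using gbinomial_negated_upper[of "of_int (- int p) :: complex" j]
  by (simp add: binomial_gbinomial of_nat_diff algebra_simps flip: power_add mult.assoc mult_2)

text \<open>In this form the coefficient of the \<open>j\<close>th term is a polynomial of degree
  \<open>j\<close> in \<open>p\<close>, on which the separation of the terms rests.\<close>

lemma iterate_minus:
  assumes "p \<ge> 1"
  shows "\<forall>\<^sub>F N in sequentially. prd k (prd (- int p) a b) c =
    (\<Sum>j<N. scale (of_nat ((p + j - 1) choose j))
      (prd (- int (p + j)) a (prd (k + int j) b c) - scale ((- 1) ^ p) (prd (k - int (p + j)) b (prd (int j) a c))))"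
proof -
  have "(- 1 :: complex) powi (- int p) = (- 1) ^ p"
    by (simp add: power_int_minus flip: power_inverse)
  moreover have "- int p - int j = - int (p + j)" "- int p + k - int j = k - int (p + j)" for j by auto
  ultimately show ?thesis
    using iterate[of k "- int p" a b c] by (simp only: gchoose_minus[OF assms])
qed

definition subalgebra :: "'v set \<Rightarrow> bool" where
  "subalgebra B \<longleftrightarrow> subspace B \<and> vac \<in> B \<and> (\<forall>k a b. a \<in> B \<longrightarrow> b \<in> B \<longrightarrow> prd k a b \<in> B)"

lemma span_words_minimal:
  assumes "subalgebra B" "S \<subseteq> B"
  shows "span (words S) \<subseteq> B"
proof (rule span_minimal)
  show "words S \<subseteq> B"
  proof
    fix w assume "w \<in> words S"
    then show "w \<in> B" by induction (use assms in \<open>auto simp: subalgebra_def\<close>)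
  qed
qed (use assms in \<open>simp add: subalgebra_def\<close>)

lemma subalgebra_span_words: "subalgebra (span (words S))"
proof -
  have word: "prd k a b \<in> span (words S)" if "a \<in> words S" "b \<in> span (words S)" for k a b
    using that(2)
    by (induction rule: span_induct_alt)
      (use that(1) in \<open>auto simp: prd_simps span_zero intro!: span_add span_scale intro: span_base words.product\<close>)
  have "prd k a b \<in> span (words S)" if "a \<in> span (words S)" "b \<in> span (words S)" for k a b
    using that(1)
    by (induction rule: span_induct_alt)
      (use that(2) word in \<open>auto simp: prd_simps span_zero intro!: span_add span_scale\<close>)
  then show ?thesis
    by (auto simp: subalgebra_def intro: span_base words.empty)
qed

text \<open>Interpolation by differences: by Pascal's rule, the difference of the sums for
  \<open>p + 1\<close> and \<open>p\<close> loses \<open>u 0\<close> and is the sum of the same kind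
  for the shifted sequence, at \<open>p + 1\<close>. So \<open>N\<close> drops by one while
  \<open>p0\<close> grows.\<close>

lemma binomial_combinations_mem:
  fixes u :: "nat \<Rightarrow> 'v"
  assumes B: "subspace B" and "p0 \<ge> 1"
    and "\<And>p. p \<ge> p0 \<Longrightarrow> (\<Sum>j<N. scale (of_nat ((p + j - 1) choose j)) (u j)) \<in> B"
    and "j < N"
  shows "u j \<in> B"
  using assms(2-)
proof (induction N arbitrary: u p0 j)
  case (Suc N)
  let ?s = "\<lambda>p. \<Sum>j<Suc N. scale (of_nat ((p + j - 1) choose j)) (u j)"
  have step: "?s (p + 1) - ?s p = (\<Sum>j<N. scale (of_nat ((p + 1 + j - 1) choose j)) (u (Suc j)))" if "p \<ge> 1" for p
  proof -
    have "((p + 1 + Suc j - 1) choose Suc j) = ((p + Suc j - 1) choose Suc j) + ((p + 1 + j - 1) choose j)" for j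
      using that by (cases p) (simp_all add: add.commute)
    then have "scale (of_nat ((p + 1 + Suc j - 1) choose Suc j)) (u (Suc j)) - scale (of_nat ((p + Suc j - 1) choose Suc j)) (u (Suc j))
        = scale (of_nat ((p + 1 + j - 1) choose j)) (u (Suc j))" for j
      by (simp only: of_nat_add scale_left_distrib) simp
    then show ?thesis
      unfolding sum.lessThan_Suc_shift by (simp add: algebra_simps flip: sum_subtractf)
  qed
  have tail: "u (Suc i) \<in> B" if "i < N" for i
  proof (rule Suc.IH[where u = "\<lambda>j. u (Suc j)" and ?p0.0 = "p0 + 1"])
    fix p assume "p0 + 1 \<le> p"
    then obtain q where q: "p = q + 1" "p0 \<le> q" by (metis add_le_cancel_right le_Suc_ex add.commute add.left_commute)
    have "?s (q + 1) - ?s q \<in> B"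
      using Suc.prems(2)[of "q + 1"] Suc.prems(2)[of q] q by (intro subspace_diff[OF B]) auto
    then show "(\<Sum>j<N. scale (of_nat ((p + j - 1) choose j)) (u (Suc j))) \<in> B"
      using step[of q] q Suc.prems(1) by simp
  qed (use that in auto)
  have "(\<Sum>j<N. scale (of_nat ((p0 + Suc j - 1) choose Suc j)) (u (Suc j))) \<in> B"
    using tail by (intro subspace_sum[OF B] subspace_scale[OF B]) auto
  with Suc.prems(2)[OF order.refl]
  have "?s p0 - (\<Sum>j<N. scale (of_nat ((p0 + Suc j - 1) choose Suc j)) (u (Suc j))) \<in> B"
    by (rule subspace_diff[OF B])
  also have "?s p0 - (\<Sum>j<N. scale (of_nat ((p0 + Suc j - 1) choose Suc j)) (u (Suc j))) = u 0"
    unfolding sum.lessThan_Suc_shift by simp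
  finally have "u 0 \<in> B" .
  with tail show ?case using Suc.prems(3) less_Suc_eq_0_disj by metis
qed simp

end

section \<open>The Heisenberg vertex algebra\<close>

context heisenberg_vertex_algebra
begin

lemma heis_commutator:
  "prd m (\<alpha> i) (prd k (\<alpha> j) c) =
    prd k (\<alpha> j) (prd m (\<alpha> i) c) + (if i = j \<and> m + k = 0 then scale (of_int m) c else 0)"
proof -
  have "\<forall>\<^sub>F N in sequentially. prd m (\<alpha> i) (prd k (\<alpha> j) c) - prd k (\<alpha> j) (prd m (\<alpha> i) c) =
      (if i = j \<and> m + k = 0 then scale (of_int m) c else 0)"
    using commutator[of m "\<alpha> i" k "\<alpha> j" c] eventually_gt_at_top[of "1::nat"]
  proof eventually_elim
    case (elim N)
    have "(\<Sum>l<N. scale (of_int m gchoose l) (prd (m + k - int l) (prd (int l) (\<alpha> i) (\<alpha> j)) c)) =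
        (\<Sum>l<N. if l = 1 then scale (of_int m) (prd (m + k - 1) (if i = j then vac else 0) c) else 0)"
      by (intro sum.cong) (auto simp: ope)
    also have "\<dots> = (if i = j \<and> m + k = 0 then scale (of_int m) c else 0)"
      using elim(2) by (auto simp: vacuum)
    finally show ?case using elim(1) by simp
  qed
  then have "prd m (\<alpha> i) (prd k (\<alpha> j) c) - prd k (\<alpha> j) (prd m (\<alpha> i) c) =
      (if i = j \<and> m + k = 0 then scale (of_int m) c else 0)"
    by simp
  then show ?thesis by (simp add: diff_eq_eq add.commute)
qed

text \<open>For positive \<open>r\<close> and \<open>s\<close> this is \<open>s\<close> times the
  polarization from copy \<open>s - 1\<close> to copy \<open>r - 1\<close>, see
  \<open>\<Phi>_pol\<close>; hence the sign of \<open>r\<close>.\<close>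

definition quad :: "int \<Rightarrow> int \<Rightarrow> 'v \<Rightarrow> 'v" where
  "quad r s v = (\<Sum>i\<in>UNIV. prd (- r) (\<alpha> i) (prd s (\<alpha> i) v))"

definition \<omega> :: "nat \<Rightarrow> nat \<Rightarrow> 'v" where
  "\<omega> a b = quad (int a) (- int b) vac"

lemma \<omega>_1: "\<omega> p 1 = (\<Sum>i\<in>UNIV. prd (- int p) (\<alpha> i) (\<alpha> i))"
  by (simp add: \<omega>_def quad_def creation)

lemma \<omega>_commute: "a \<ge> 1 \<Longrightarrow> b \<ge> 1 \<Longrightarrow> \<omega> a b = \<omega> b a"
  unfolding \<omega>_def quad_def by (intro sum.cong refl) (simp add: heis_commutator[of "- int a"])

text \<open>The iterate formula, summed over \<open>i\<close>. All operators \<open>quad r s\<close>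
  that occur satisfy \<open>s - r = k - p\<close>.\<close>

lemma \<omega>_mode:
  assumes "p \<ge> 1"
  shows "\<forall>\<^sub>F N in sequentially. prd k (\<omega> p 1) v =
    (\<Sum>j<N. scale (of_nat ((p + j - 1) choose j))
      (quad (int (p + j)) (k + int j) v - scale ((- 1) ^ p) (quad (int (p + j) - k) (int j) v)))"
proof -
  have "\<forall>\<^sub>F N in sequentially. \<forall>i\<in>UNIV. prd k (prd (- int p) (\<alpha> i) (\<alpha> i)) v =
    (\<Sum>j<N. scale (of_nat ((p + j - 1) choose j))
      (prd (- int (p + j)) (\<alpha> i) (prd (k + int j) (\<alpha> i) v) - scale ((- 1) ^ p) (prd (k - int (p + j)) (\<alpha> i) (prd (int j) (\<alpha> i) v))))"
    by (intro eventually_ball_finite ballI iterate_minus assms) simp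
  then show ?thesis
  proof eventually_elim
    case (elim N)
    have "prd k (\<omega> p 1) v = (\<Sum>i\<in>UNIV. \<Sum>j<N. scale (of_nat ((p + j - 1) choose j))
      (prd (- int (p + j)) (\<alpha> i) (prd (k + int j) (\<alpha> i) v) - scale ((- 1) ^ p) (prd (k - int (p + j)) (\<alpha> i) (prd (int j) (\<alpha> i) v))))"
      unfolding \<omega>_1 prd_sum using elim by (intro sum.cong) auto
    also have "\<dots> = (\<Sum>j<N. \<Sum>i\<in>UNIV. scale (of_nat ((p + j - 1) choose j))
      (prd (- int (p + j)) (\<alpha> i) (prd (k + int j) (\<alpha> i) v) - scale ((- 1) ^ p) (prd (k - int (p + j)) (\<alpha> i) (prd (int j) (\<alpha> i) v))))"
      by (rule sum.swap)
    also have "\<dots> = (\<Sum>j<N. scale (of_nat ((p + j - 1) choose j))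
      (quad (int (p + j)) (k + int j) v - scale ((- 1) ^ p) (quad (int (p + j) - k) (int j) v)))"
      by (intro sum.cong refl) (simp add: quad_def scale_sum_right[symmetric] sum_subtractf)
    finally show ?case .
  qed
qed

text \<open>The annihilating mode contracts with either of the two factors of
  \<open>\<omega> a b\<close>; the new factor with index \<open>r\<close> takes its place.\<close>

lemma quad_\<omega>:
  assumes "s \<ge> 0"
  shows "quad (int r) s (\<omega> a b) =
    (if s = int a then scale (of_nat a) (\<omega> r b) else 0) + (if s = int b then scale (of_nat b) (\<omega> r a) else 0)"
proof -
  let ?d = "\<lambda>a. if s = int a then of_nat a else (0 :: complex)"
  have *: "prd s (\<alpha> i) (\<omega> a b) =
      scale (?d a) (prd (- int b) (\<alpha> i) vac) + scale (?d b) (prd (- int a) (\<alpha> i) vac)" for i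
  proof -
    have "prd s (\<alpha> i) (prd (- int a) (\<alpha> l) (prd (- int b) (\<alpha> l) vac)) =
        (if l = i then scale (?d a) (prd (- int b) (\<alpha> i) vac) + scale (?d b) (prd (- int a) (\<alpha> i) vac) else 0)" for l
      using assms by (auto simp: heis_commutator[of s] creation_nonneg prd_simps)
    then show ?thesis by (simp add: \<omega>_def quad_def prd_sum)
  qed
  show ?thesis
    unfolding quad_def * prd_simps sum.distrib scale_sum_right[symmetric]
    by (simp add: \<omega>_def quad_def)
qed

text \<open>\<open>\<omega> 1 1\<close> is twice the conformal vector, so its mode 0 is twice the
  translation operator, a derivation that raises the index \<open>a\<close> of a factor with
  coefficient \<open>a\<close>.\<close>

lemma \<omega>_1_mode:
  "prd 0 (\<omega> 1 1) (\<omega> a b) = scale 2 (scale (of_nat a) (\<omega> (a + 1) b) + scale (of_nat b) (\<omega> (b + 1) a))"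
proof -
  let ?f = "\<lambda>j. (if j = a then scale (2 * of_nat a) (\<omega> (a + 1) b) else 0) + (if j = b then scale (2 * of_nat b) (\<omega> (b + 1) a) else 0)"
  have "\<forall>\<^sub>F N in sequentially. prd 0 (\<omega> 1 1) (\<omega> a b) = scale 2 (scale (of_nat a) (\<omega> (a + 1) b) + scale (of_nat b) (\<omega> (b + 1) a))"
    using \<omega>_mode[OF order.refl, of 0 "\<omega> a b"] eventually_gt_at_top[of a] eventually_gt_at_top[of b]
  proof eventually_elim
    case (elim N)
    have "prd 0 (\<omega> 1 1) (\<omega> a b) = (\<Sum>j<N. ?f j)"
      unfolding elim(1)
    proof (intro sum.cong refl)
      fix j :: nat
      have "quad (1 + int j) (int j) (\<omega> a b) =
          (if j = a then scale (of_nat a) (\<omega> (a + 1) b) else 0) + (if j = b then scale (of_nat b) (\<omega> (b + 1) a) else 0)"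
        using quad_\<omega>[of "int j" "1 + j" a b] by (auto simp: add.commute)
      note q = this
      have "scale (of_nat (1 + j - 1 choose j))
          (quad (int (1 + j)) (0 + int j) (\<omega> a b) - scale ((- 1) ^ 1) (quad (int (1 + j) - 0) (int j) (\<omega> a b))) =
          scale 2 (quad (1 + int j) (int j) (\<omega> a b))"
        using scale_left_distrib[of 1 1 "quad (1 + int j) (int j) (\<omega> a b)"] by simp
      also have "\<dots> = ?f j"
        unfolding q by (auto simp: scale_right_distrib)
      finally show "scale (of_nat (1 + j - 1 choose j))
          (quad (int (1 + j)) (0 + int j) (\<omega> a b) - scale ((- 1) ^ 1) (quad (int (1 + j) - 0) (int j) (\<omega> a b))) = ?f j" .
    qed
    also have "\<dots> = scale (2 * of_nat a) (\<omega> (a + 1) b) + scale (2 * of_nat b) (\<omega> (b + 1) a)"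
      using elim(2,3) by (simp add: sum.distrib)
    finally show ?case by (simp add: scale_right_distrib)
  qed
  then show ?thesis by simp
qed

text \<open>Two terms of the mode expansion, \<open>j = a - 1\<close> and \<open>j = a\<close>,
  contribute to \<open>\<omega> (a + 2) b\<close>; their binomials add up, as
  \<open>((a + 1) choose 2) + ((a + 2) choose 2) = (a + 1) ^ 2\<close>.\<close>

lemma \<omega>_3_mode:
  assumes "a \<ge> 1" "b \<ge> 1"
  shows "prd 1 (\<omega> 3 1) (\<omega> a b) =
    scale (of_nat (a * (a + 1) ^ 2)) (\<omega> (a + 2) b) + scale (of_nat (b * (b + 1) ^ 2)) (\<omega> (b + 2) a)"
proof -
  let ?c = "\<lambda>j. of_nat ((j + 2) choose j) :: complex"
  let ?g = "\<lambda>j. (if j = a - 1 then scale (?c j * of_nat a) (\<omega> (a + 2) b) else 0) + (if j = b - 1 then scale (?c j * of_nat b) (\<omega> (b + 2) a) else 0)"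
  let ?f = "\<lambda>j. (if j = a then scale (?c j * of_nat a) (\<omega> (a + 2) b) else 0) + (if j = b then scale (?c j * of_nat b) (\<omega> (b + 2) a) else 0)"
  have c: "?c (j - 1) * of_nat j + ?c j * of_nat j = of_nat (j * (j + 1) ^ 2)" if j1: "j \<ge> 1" for j
  proof -
    obtain i where j: "j = Suc i" using j1 by (cases j) auto
    have ch: "2 * ((n + 2) choose n) = (n + 2) * (n + 1)" for n :: nat
      using binomial_symmetric[of n "n + 2"] by (simp add: choose_two)
    have "2 * (((i + 2) choose i) * j + ((j + 2) choose j) * j) =
        (2 * ((i + 2) choose i)) * j + (2 * ((j + 2) choose j)) * j"
      by (simp only: distrib_left mult.assoc)
    also have "\<dots> = 2 * (j * (j + 1) ^ 2)"
      unfolding ch by (simp add: j power2_eq_square algebra_simps)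
    finally have "2 * (((i + 2) choose i) * j + ((j + 2) choose j) * j) = 2 * (j * (j + 1) ^ 2)" .
    then have "((i + 2) choose i) * j + ((j + 2) choose j) * j = j * (j + 1) ^ 2" by simp
    then have "of_nat (((i + 2) choose i) * j + ((j + 2) choose j) * j) = (of_nat (j * (j + 1) ^ 2) :: complex)"
      by (rule arg_cong)
    moreover have "j - 1 = i" using j by simp
    ultimately show ?thesis by (simp only: of_nat_add of_nat_mult)
  qed
  have three: "(1::nat) \<le> 3" by simp
  have "\<forall>\<^sub>F N in sequentially. prd 1 (\<omega> 3 1) (\<omega> a b) =
      scale (of_nat (a * (a + 1) ^ 2)) (\<omega> (a + 2) b) + scale (of_nat (b * (b + 1) ^ 2)) (\<omega> (b + 2) a)"
    using \<omega>_mode[OF three, of 1 "\<omega> a b"] eventually_gt_at_top[of a] eventually_gt_at_top[of b]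
  proof eventually_elim
    case (elim N)
    have "prd 1 (\<omega> 3 1) (\<omega> a b) = (\<Sum>j<N. ?g j + ?f j)"
      unfolding elim(1)
    proof (intro sum.cong refl)
      fix j :: nat
      have eqs: "3 + j - 1 = j + 2" "int (3 + j) - 1 = int (2 + j)" by auto
      have q1: "quad (int (3 + j)) (1 + int j) (\<omega> a b) =
          (if j = a - 1 then scale (of_nat a) (\<omega> (a + 2) b) else 0) + (if j = b - 1 then scale (of_nat b) (\<omega> (b + 2) a) else 0)"
      proof -
        have *: "1 + int j = int c \<longleftrightarrow> j = c - 1" "j = c - 1 \<Longrightarrow> 3 + j = c + 2" if "c \<ge> 1" for c
          using that by linarith+
        have "quad (int (3 + j)) (1 + int j) (\<omega> a b) =
          (if j = a - 1 then scale (of_nat a) (\<omega> (3 + j) b) else 0) + (if j = b - 1 then scale (of_nat b) (\<omega> (3 + j) a) else 0)"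
          using quad_\<omega>[of "1 + int j" "3 + j" a b] unfolding *(1)[OF assms(1)] *(1)[OF assms(2)] by simp
        then show ?thesis
          using *(2)[OF assms(1)] *(2)[OF assms(2)]
          by (simp only: cong: if_cong)
      qed
      have q2: "quad (int (2 + j)) (int j) (\<omega> a b) =
          (if j = a then scale (of_nat a) (\<omega> (a + 2) b) else 0) + (if j = b then scale (of_nat b) (\<omega> (b + 2) a) else 0)"
        using quad_\<omega>[of "int j" "2 + j" a b] by (simp only: of_nat_eq_iff add.commute[of 2] of_nat_0_le_iff cong: if_cong)
      show "scale (of_nat (3 + j - 1 choose j)) (quad (int (3 + j)) (1 + int j) (\<omega> a b)
          - scale ((- 1) ^ 3) (quad (int (3 + j) - 1) (int j) (\<omega> a b))) = ?g j + ?f j"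
        unfolding eqs q1 q2 by (auto simp: scale_right_distrib)
    qed
    also have "\<dots> = scale (?c (a - 1) * of_nat a + ?c a * of_nat a) (\<omega> (a + 2) b) + scale (?c (b - 1) * of_nat b + ?c b * of_nat b) (\<omega> (b + 2) a)"
    proof -
      have "a - Suc 0 < N" "b - Suc 0 < N" using elim(2,3) by auto
      then show ?thesis using elim(2,3) by (simp add: sum.distrib scale_left_distrib)
    qed
    finally show ?case unfolding c[OF assms(1)] c[OF assms(2)] .
  qed
  then show ?thesis by simp
qed

text \<open>The mode \<open>0\<close> of \<open>\<omega> 1 1\<close> and the mode \<open>1\<close> of \<open>\<omega> 3 1\<close> produce \<open>\<omega> (a + 1) (a + 1)\<close> from \<open>\<omega> a a\<close>: both the square of the first
  and the second yield \<open>\<omega> (a + 2) a\<close>, but only the former yields \<open>\<omega> (a + 1) (a + 1)\<close>.\<close>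

lemma \<omega>_in_subalgebra:
  assumes B: "subalgebra B" and gen: "\<omega> 1 1 \<in> B" "\<omega> 3 1 \<in> B" and "a \<ge> 1" "b \<ge> 1"
  shows "\<omega> a b \<in> B"
proof -
  have sub: "subspace B" and prod: "x \<in> B \<Longrightarrow> y \<in> B \<Longrightarrow> prd k x y \<in> B" for k x y
    using B by (auto simp: subalgebra_def)
  have div: "x \<in> B" if "scale (of_nat n) x \<in> B" "n \<ge> 1" for n x
    using subspace_scale[OF sub that(1), of "inverse (of_nat n)"] that(2) by simp
  have rest: "x \<in> B" if "x + y \<in> B" "y \<in> B" for x y
    using subspace_diff[OF sub that] by simp
  have T: "scale (of_nat a) (\<omega> (a + 1) b) + scale (of_nat b) (\<omega> (b + 1) a) \<in> B" if "\<omega> a b \<in> B" for a b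
  proof (rule div[of 2])
    show "scale (of_nat 2) (scale (of_nat a) (\<omega> (a + 1) b) + scale (of_nat b) (\<omega> (b + 1) a)) \<in> B"
      using prod[OF gen(1) that, of 0] unfolding \<omega>_1_mode by simp
  qed simp
  have diag1: "\<omega> (a + 1) a \<in> B" if "\<omega> a a \<in> B" "a \<ge> 1" for a
  proof -
    have "scale (of_nat (2 * a)) (\<omega> (a + 1) a) \<in> B"
      using T[OF that(1)] by (simp flip: scale_left_distrib)
    then show ?thesis by (rule div[of "2 * a"]) (use that(2) in simp)
  qed
  have diag: "\<omega> (Suc k) (Suc k) \<in> B" for k
  proof (induction k)
    case (Suc k)
    define a where "a = Suc k"
    have aa: "\<omega> a a \<in> B" and a1: "a \<ge> 1" using Suc by (simp_all add: a_def)
    have "scale (of_nat (2 * (a * (a + 1) ^ 2))) (\<omega> (a + 2) a) \<in> B"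
      using prod[OF gen(2) aa, of 1] unfolding \<omega>_3_mode[OF a1 a1] by (simp flip: scale_left_distrib)
    then have a2: "\<omega> (a + 2) a \<in> B" by (rule div[of "2 * (a * (a + 1) ^ 2)"]) (use a1 in simp)
    have "scale (of_nat a) (\<omega> (a + 1) (a + 1)) + scale (of_nat (a + 1)) (\<omega> (a + 2) a) \<in> B"
      using T[OF diag1[OF aa a1]] by (simp add: add.commute)
    then have "scale (of_nat a) (\<omega> (a + 1) (a + 1)) \<in> B"
      using subspace_scale[OF sub a2] by (rule rest)
    then have "\<omega> (a + 1) (a + 1) \<in> B" by (rule div) (use a1 in simp)
    then show ?case by (simp add: a_def)
  qed (use gen in simp)
  \<comment> \<open>Induction on the difference \<open>k\<close> of the indices: translating the
    vector of difference \<open>k - 1\<close> gives the desired one plus a multiple of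
    \<open>\<omega> (a + 1) (a + k - 1)\<close>, of difference \<open>k - 2\<close>.\<close>
  have ge: "\<omega> (a + k) a \<in> B" if "a \<ge> 1" for a k
    using that
  proof (induction k arbitrary: a rule: less_induct)
    case (less k)
    have aa: "\<omega> a a \<in> B" using diag[of "a - 1"] less.prems by simp
    consider "k = 0" | "k = 1" | "k \<ge> 2" by linarith
    then show ?case
    proof cases
      case 3
      define l where "l = k - 2"
      have k: "k = Suc (Suc l)" using 3 by (simp add: l_def)
      have IH1: "\<omega> (a + Suc l) a \<in> B" using less.IH[of "Suc l" a] less.prems k by simp
      have "\<omega> ((a + 1) + l) (a + 1) \<in> B" using less.IH[of l "a + 1"] k by simp
      then have "\<omega> (a + 1) (a + Suc l) \<in> B" using less.prems by (simp add: \<omega>_commute[of "Suc a"])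
      then have "scale (of_nat a) (\<omega> (a + 1) (a + Suc l)) \<in> B" by (rule subspace_scale[OF sub])
      with T[OF IH1] have "scale (of_nat (a + Suc l)) (\<omega> (a + Suc l + 1) a) \<in> B" by (rule rest)
      then have "\<omega> (a + Suc l + 1) a \<in> B" by (rule div) simp
      then show ?thesis using k by simp
    qed (use aa diag1[OF aa less.prems] in simp_all)
  qed
  show ?thesis
  proof (cases "a \<ge> b")
    case True
    then show ?thesis using ge[of b "a - b"] assms by simp
  next
    case False
    then show ?thesis using ge[of a "b - a"] assms \<omega>_commute[of a b] by simp
  qed
qed

text \<open>Applied to a fixed vector, the mode \<open>p + m\<close> of \<open>\<omega> p 1\<close> is, for large \<open>p\<close>, a combination of finitely many
  operators \<open>quad r s\<close> with \<open>s - r = m\<close>, whose coefficients are polynomials of distinct degrees in \<open>p\<close>.\<close>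

lemma quad_in_subalgebra:
  assumes B: "subalgebra B" and gen: "\<omega> 1 1 \<in> B" "\<omega> 3 1 \<in> B" and v: "v \<in> B" and s: "s \<ge> 0"
  shows "quad r s v \<in> B"
proof -
  have sub: "subspace B" using B by (simp add: subalgebra_def)
  have "\<forall>i. \<exists>N. \<forall>k\<ge>N. prd k (\<alpha> i) v = 0" using truncation by blast
  from choice[OF this] obtain Nf where Nf: "\<And>i k. k \<ge> Nf i \<Longrightarrow> prd k (\<alpha> i) v = 0" by blast
  define N0 where "N0 = nat (Max (range Nf))"
  have N0: "prd k (\<alpha> i) v = 0" if "k \<ge> int N0" for i k
  proof -
    have "Nf i \<le> Max (range Nf)" by simp
    also have "\<dots> \<le> int N0" unfolding N0_def by linarith
    finally show ?thesis using that by (intro Nf) simp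
  qed
  then have quad_0: "quad r' k v = 0" if "k \<ge> int N0" for r' k using that by (simp add: quad_def)
  define m where "m = s - r"
  \<comment> \<open>From \<open>p0\<close> on, the inner mode \<open>p + m + j\<close> in the first
    half of each summand is at least \<open>N0\<close> and annihilates \<open>v\<close>; only the
    second half remains.\<close>
  define p0 where "p0 = nat (max 1 (int N0 - m))"
  have p0: "p0 \<ge> 1" "int p0 + m \<ge> int N0" by (auto simp: p0_def)
  have "(\<Sum>j<N0. scale (of_nat ((p + j - 1) choose j)) (quad (int j - m) (int j) v)) \<in> B" if p: "p \<ge> p0" for p
  proof -
    let ?t = "\<lambda>j. scale (of_nat ((p + j - 1) choose j)) (quad (int j - m) (int j) v)"
    have "\<forall>\<^sub>F N in sequentially. prd (int p + m) (\<omega> p 1) v = scale (- ((- 1) ^ p)) (\<Sum>j<N0. ?t j)"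
      using \<omega>_mode[of p "int p + m" v, OF order.trans[OF p0(1) p]] eventually_ge_at_top[of N0]
    proof eventually_elim
      case (elim N)
      have "prd (int p + m) (\<omega> p 1) v = (\<Sum>j<N. scale (- ((- 1) ^ p)) (?t j))"
        unfolding elim(1)
      proof (intro sum.cong refl)
        fix j
        have 1: "quad (int (p + j)) (int p + m + int j) v = 0" using p p0(2) by (intro quad_0) auto
        have 2: "int (p + j) - (int p + m) = int j - m" by simp
        show "scale (of_nat (p + j - 1 choose j))
          (quad (int (p + j)) (int p + m + int j) v - scale ((- 1) ^ p) (quad (int (p + j) - (int p + m)) (int j) v)) =
          scale (- ((- 1) ^ p)) (?t j)"
          unfolding 1 2 by (simp add: mult.commute)
      qed
      also have "\<dots> = (\<Sum>j<N0. scale (- ((- 1) ^ p)) (?t j))"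
        using elim(2) by (intro sum.mono_neutral_right) (auto simp: quad_0)
      finally show ?case by (simp add: scale_sum_right)
    qed
    then have "prd (int p + m) (\<omega> p 1) v = scale (- ((- 1) ^ p)) (\<Sum>j<N0. ?t j)" by simp
    moreover have "prd (int p + m) (\<omega> p 1) v \<in> B"
      using B v \<omega>_in_subalgebra[OF B gen, of p 1] p p0(1) by (auto simp: subalgebra_def)
    ultimately have "scale (- ((- 1) ^ p)) (\<Sum>j<N0. ?t j) \<in> B" by simp
    then have "scale (- ((- 1) ^ p)) (scale (- ((- 1) ^ p)) (\<Sum>j<N0. ?t j)) \<in> B"
      by (rule subspace_scale[OF sub])
    moreover have "(- ((- 1) ^ p)) * (- ((- 1) ^ p)) = (1 :: complex)"
      by (simp flip: power_mult_distrib)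
    ultimately show ?thesis by (simp only: scale_scale scale_one)
  qed
  then have "quad (int (nat s) - m) (int (nat s)) v \<in> B" if "nat s < N0"
    using binomial_combinations_mem[OF sub p0(1), of "\<lambda>j. quad (int j - m) (int j) v" N0 "nat s"] that by blast
  moreover have "quad r s v = 0" if "\<not> nat s < N0" using that s by (intro quad_0) linarith
  ultimately show ?thesis using s sub by (cases "nat s < N0") (auto simp: m_def subspace_0)
qed

end

section \<open>Bounds on the degree\<close>

lemma deg_less_iff: "deg_less d P \<longleftrightarrow> (\<forall>m. coef P m \<noteq> 0 \<longrightarrow> size m < d)"
  by (auto simp: deg_less_def in_keys_iff)

lemma deg_less_add: "deg_less d P \<Longrightarrow> deg_less d Q \<Longrightarrow> deg_less d (P + Q)"
  unfolding deg_less_iff lookup_add by (metis add.right_neutral)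

lemma deg_less_cmul: "deg_less d P \<Longrightarrow> deg_less d (cmul c P)"
  by (simp add: deg_less_iff)

lemma deg_less_0 [simp]: "deg_less d 0"
  by (simp add: deg_less_iff)

lemma deg_less_zero_iff: "deg_less 0 P \<longleftrightarrow> P = 0"
  by (auto simp: deg_less_def)

lemma deg_less_mono: "deg_less d P \<Longrightarrow> d \<le> d' \<Longrightarrow> deg_less d' P"
  by (auto simp: deg_less_def)

lemma deg_less_X_mult: "deg_less d P \<Longrightarrow> deg_less (Suc d) (Var x * P)"
  by (auto simp: deg_less_def keys_X_mult)

lemma deg_less_pd: "deg_less d P \<Longrightarrow> deg_less (d - 1) (pd x P)"
  by (force simp: deg_less_def keys_pd)

lemma hom_deg_less: "homogeneous d P \<Longrightarrow> deg_less (Suc d) P"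
  by (auto simp: homogeneous_def deg_less_def)

lemma deg_less_pol: "deg_less d P \<Longrightarrow> deg_less d (polarize r s P)"
  unfolding deg_less_def by (auto elim!: keys_polD)

context heisenberg_vertex_algebra
begin

section \<open>The identification with the polynomial ring\<close>

text \<open>The variable \<open>(i, k)\<close> corresponds to the mode \<open>\<alpha>\<^sup>i(-k-1)\<close>.\<close>

definition creation_op :: "'n \<times> nat \<Rightarrow> 'v \<Rightarrow> 'v" where
  "creation_op x = prd (- int (snd x + 1)) (\<alpha> (fst x))"

lemma cr_commute: "creation_op x (creation_op y v) = creation_op y (creation_op x v)"
  unfolding creation_op_def by (subst heis_commutator) auto

definition fock_monomial :: "('n \<times> nat) multiset \<Rightarrow> 'v" where
  "fock_monomial m = fold_mset creation_op vac m"

lemma fock_monomial_simps: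
  "fock_monomial {#} = vac"
  "fock_monomial (add_mset x m) = creation_op x (fock_monomial m)"
proof -
  interpret comp_fun_commute creation_op
    by unfold_locales (auto simp: cr_commute)
  show "fock_monomial {#} = vac" "fock_monomial (add_mset x m) = creation_op x (fock_monomial m)"
    by (simp_all add: fock_monomial_def)
qed

definition \<Phi> :: "('n \<times> nat) mpoly \<Rightarrow> 'v" where
  "\<Phi> P = (\<Sum>m\<in>supp P. scale (coef P m) (fock_monomial m))"

lemma \<Phi>_eq:
  assumes "finite A" "supp P \<subseteq> A"
  shows "\<Phi> P = (\<Sum>m\<in>A. scale (coef P m) (fock_monomial m))"
  unfolding \<Phi>_def using assms by (intro sum.mono_neutral_left) (auto simp: in_keys_iff)

lemma \<Phi>_add: "\<Phi> (P + Q) = \<Phi> P + \<Phi> Q"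
proof -
  let ?A = "supp P \<union> supp Q"
  have *: "\<Phi> h = (\<Sum>m\<in>?A. scale (coef h m) (fock_monomial m))" if "supp h \<subseteq> ?A" for h
    by (rule \<Phi>_eq) (use that in auto)
  have "supp (P + Q) \<subseteq> ?A" by (rule keys_add)
  then show ?thesis
    by (simp add: * lookup_add scale_left_distrib sum.distrib)
qed

lemma \<Phi>_monom: "\<Phi> (mon m c) = scale c (fock_monomial m)"
  by (subst \<Phi>_eq[of "{m}"]) auto

lemma \<Phi>_0 [simp]: "\<Phi> 0 = 0"
  by (simp add: \<Phi>_def)

lemma \<Phi>_cmul: "\<Phi> (cmul c P) = scale c (\<Phi> P)"
  by (induction P rule: mpoly_induct) (auto simp: cmul_monom \<Phi>_monom \<Phi>_add mp.scale_right_distrib scale_right_distrib)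

lemma \<Phi>_diff: "\<Phi> (P - Q) = \<Phi> P - \<Phi> Q"
  using \<Phi>_add[of "P - Q" Q] by simp

lemma \<Phi>_sum: "\<Phi> (sum f A) = (\<Sum>a\<in>A. \<Phi> (f a))"
  by (induction A rule: infinite_finite_induct) (auto simp: \<Phi>_add)

lemma cr_linear: "creation_op x (v + w) = creation_op x v + creation_op x w" "creation_op x (scale c v) = scale c (creation_op x v)" "creation_op x 0 = 0"
  by (simp_all add: creation_op_def prd_simps)

lemma \<Phi>_X_mult: "\<Phi> (Var x * P) = creation_op x (\<Phi> P)"
  by (induction P rule: mpoly_induct)
    (auto simp: mult_single \<Phi>_monom fock_monomial_simps cr_linear distrib_left \<Phi>_add)

text \<open>This mode kills the vacuum, and among the creation operators it fails to commute only
  with that of \<open>(i, l)\<close>, where the commutator is the scalar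
  \<open>l + 1\<close>.\<close>

lemma annihilate_\<Phi>:
  "prd (int (Suc l)) (\<alpha> i) (\<Phi> P) = scale (of_nat (Suc l)) (\<Phi> (pd (i, l) P))"
proof (induction P rule: mpoly_induct)
  case (monom m c)
  have "prd (int (Suc l)) (\<alpha> i) (\<Phi> (mon m 1)) = scale (of_nat (Suc l)) (\<Phi> (pd (i, l) (mon m 1)))"
  proof (induction m)
    case empty
    show ?case by (simp add: \<Phi>_monom fock_monomial_simps creation_nonneg del: single_one)
  next
    case (add x m)
    obtain j k where x: "x = (j, k)" by (cases x)
    have "prd (int (Suc l)) (\<alpha> i) (\<Phi> (mon (add_mset x m) 1)) =
        creation_op x (prd (int (Suc l)) (\<alpha> i) (\<Phi> (mon m 1))) +
        (if (i, l) = x then scale (of_nat (Suc l)) (\<Phi> (mon m 1)) else 0)"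
      unfolding monom_add_mset[of x m] \<Phi>_X_mult creation_op_def
      by (subst heis_commutator) (auto simp: x)
    also have "\<dots> = scale (of_nat (Suc l)) (\<Phi> (pd (i, l) (mon (add_mset x m) 1)))"
      unfolding add.IH monom_add_mset[of x m] pd_X_mult \<Phi>_add \<Phi>_X_mult cr_linear
      by (auto simp: scale_right_distrib add.commute)
    finally show ?case .
  qed
  then show ?case
    by (subst (1 2) monom_eq_cmul) (simp only: \<Phi>_cmul pd_cmul prd_simps scale_left_commute)
qed (simp only: \<Phi>_add pd_add prd_simps scale_right_distrib)

lemma annihilate_0_\<Phi>: "prd 0 (\<alpha> i) (\<Phi> P) = 0"
proof (induction P rule: mpoly_induct)
  case (monom m c)
  have "prd 0 (\<alpha> i) (fock_monomial m) = 0"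
  proof (induction m)
    case (add x m)
    have "prd 0 (\<alpha> i) (creation_op x (fock_monomial m)) = creation_op x (prd 0 (\<alpha> i) (fock_monomial m))"
      unfolding creation_op_def by (subst heis_commutator) auto
    then show ?case using add by (simp add: fock_monomial_simps cr_linear)
  qed (simp add: fock_monomial_simps creation_nonneg)
  then show ?case by (simp add: \<Phi>_monom prd_simps)
qed (simp add: \<Phi>_add prd_simps)

lemma mode_range_\<Phi>: "\<exists>P'. prd k (\<alpha> i) (\<Phi> P) = \<Phi> P'"
proof (cases "k < 0")
  case True
  have "prd k (\<alpha> i) (\<Phi> P) = \<Phi> (Var (i, nat (- k) - 1) * P)"
    using True unfolding \<Phi>_X_mult by (simp add: creation_op_def of_nat_diff)
  then show ?thesis ..
next
  case False
  then consider "k = 0" | l where "k = int (Suc l)"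
    by (metis int_cases not0_implies_Suc of_nat_0 negative_zless)
  then show ?thesis
  proof cases
    case 1
    then show ?thesis using annihilate_0_\<Phi> \<Phi>_0 by metis
  next
    case 2
    then show ?thesis using annihilate_\<Phi> \<Phi>_cmul by metis
  qed
qed

lemma subspace_range_\<Phi>: "subspace (range \<Phi>)"
  unfolding subspace_def
proof (intro conjI ballI allI)
  show "0 \<in> range \<Phi>" by (rule image_eqI[of _ _ 0]) simp_all
next
  fix v w assume "v \<in> range \<Phi>" "w \<in> range \<Phi>"
  then show "v + w \<in> range \<Phi>" by (auto simp flip: \<Phi>_add)
next
  fix c v assume "v \<in> range \<Phi>"
  then show "scale c v \<in> range \<Phi>" by (auto simp flip: \<Phi>_cmul)
qed

text \<open>By the iterate formula the range is stable under all modes of words in the generators.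
  As it contains \<open>vac\<close>, it contains each word, which is its own mode -1 applied to
  \<open>vac\<close>.\<close>

lemma surj_\<Phi>: "surj \<Phi>"
proof -
  have mode: "prd k w v \<in> range \<Phi>" if "w \<in> words (range \<alpha>)" "v \<in> range \<Phi>" for k w v
    using that
  proof (induction arbitrary: k v)
    case empty
    then show ?case using subspace_0[OF subspace_range_\<Phi>] by (simp add: vacuum)
  next
    case (letter s)
    then show ?case using mode_range_\<Phi> by (auto simp: image_iff)
  next
    case (product a b n)
    obtain N where "prd k (prd n a b) v =
      (\<Sum>j<N. scale ((- 1) ^ j * (of_int n gchoose j))
        (prd (n - int j) a (prd (k + int j) b v) - scale ((- 1) powi n) (prd (n + k - int j) b (prd (int j) a v))))"
      using eventually_happens[OF iterate[of k n a b v]] by auto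
    also have "\<dots> \<in> range \<Phi>"
      using product
      by (intro subspace_sum subspace_scale subspace_diff subspace_range_\<Phi>) auto
    finally show ?case .
  qed
  have "vac = \<Phi> (mon {#} 1)" by (simp add: \<Phi>_monom fock_monomial_simps del: single_one)
  then have vac: "vac \<in> range \<Phi>" by blast
  have "words (range \<alpha>) \<subseteq> range \<Phi>"
    using mode[OF _ vac, of _ "- 1"] by (auto simp: creation)
  then have "span (words (range \<alpha>)) \<subseteq> range \<Phi>"
    using subspace_range_\<Phi> by (rule span_minimal)
  then show ?thesis using generated by auto
qed

text \<open>The kernel is closed under derivatives, which have lower degree and so vanish by
  induction. Then \<open>P\<close> is constant, and \<open>vac_nonzero\<close> finishes.\<close>

lemma \<Phi>_eq_0: "\<Phi> P = 0 \<Longrightarrow> P = 0"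
proof -
  have "P = 0" if "deg_less d P" "\<Phi> P = 0" for d and P
    using that
  proof (induction d arbitrary: P)
    case (Suc d)
    have pd0: "pd x P = 0" for x
    proof (rule Suc.IH)
      show "deg_less d (pd x P)" using deg_less_pd[OF Suc.prems(1)] by simp
      obtain i l where x: "x = (i, l)" by (cases x)
      have "of_nat (Suc l) \<noteq> (0 :: complex)" by (simp only: of_nat_eq_0_iff)
      then show "\<Phi> (pd x P) = 0"
        using annihilate_\<Phi>[of l i P] Suc.prems(2) unfolding x by simp
    qed
    have "supp P \<subseteq> {{#}}"
    proof
      fix m assume "m \<in> supp P"
      then have "x \<notin># m" for x using pd0[of x] by (simp add: pd_eq_0_iff)
      then show "m \<in> {{#}}" by (auto simp: multiset_eq_iff not_in_iff)
    qed
    then have "P = mon {#} (coef P {#})"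
      by (intro poly_mapping_eqI) (auto simp: lookup_single when_def in_keys_iff)
    moreover from this have "scale (coef P {#}) vac = 0"
      using Suc.prems(2) \<Phi>_monom[of "{#}" "coef P {#}"] by (simp add: fock_monomial_simps)
    then have "coef P {#} = 0" using vac_nonzero by simp
    ultimately show ?case by simp
  qed (simp add: deg_less_zero_iff)
  moreover have "deg_less (Suc (Max (size ` supp P))) P"
    by (auto simp: deg_less_def less_Suc_eq_le)
  ultimately show "\<Phi> P = 0 \<Longrightarrow> P = 0" by blast
qed

lemma \<Phi>_inject: "\<Phi> P = \<Phi> Q \<longleftrightarrow> P = Q"
  using \<Phi>_eq_0[of "P - Q"] by (auto simp: \<Phi>_diff)

lemma \<Phi>_pol: "scale (of_nat (Suc s)) (\<Phi> (polarize r s P)) = quad (int (Suc r)) (int (Suc s)) (\<Phi> P)"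
  by (simp add: polarize_def quad_def \<Phi>_sum \<Phi>_X_mult annihilate_\<Phi>[unfolded of_nat_Suc] prd_simps scale_sum_right creation_op_def add.commute)

text \<open>Serves two subalgebras: it makes both the invariants and the subalgebra generated by the
  chosen finite set stable under polarization.\<close>

lemma pol_in_subalgebra:
  assumes "subalgebra B" "\<omega> 1 1 \<in> B" "\<omega> 3 1 \<in> B" "\<Phi> P \<in> B"
  shows "\<Phi> (polarize r s P) \<in> B"
proof -
  have sub: "subspace B" using assms(1) by (simp add: subalgebra_def)
  have "scale (of_nat (Suc s)) (\<Phi> (polarize r s P)) \<in> B"
    unfolding \<Phi>_pol using assms by (intro quad_in_subalgebra) auto
  from subspace_scale[OF sub this, of "inverse (of_nat (Suc s))"]
  show ?thesis by (simp del: of_nat_Suc)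
qed


section \<open>The filtration by degree and the product of index -1\<close>

definition filtration :: "nat \<Rightarrow> 'v set" where
  "filtration d = \<Phi> ` {P. deg_less d P}"

lemma subspace_fil: "subspace (filtration d)"
  unfolding subspace_def filtration_def
proof (intro conjI ballI allI)
  show "0 \<in> \<Phi> ` {P. deg_less d P}" by (rule image_eqI[of _ _ 0]) simp_all
next
  fix v w assume "v \<in> \<Phi> ` {P. deg_less d P}" "w \<in> \<Phi> ` {P. deg_less d P}"
  then show "v + w \<in> \<Phi> ` {P. deg_less d P}" by (auto simp: deg_less_add simp flip: \<Phi>_add)
next
  fix c v assume "v \<in> \<Phi> ` {P. deg_less d P}"
  then show "scale c v \<in> \<Phi> ` {P. deg_less d P}" by (auto simp: deg_less_cmul simp flip: \<Phi>_cmul)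
qed

lemma fil_mono: "v \<in> filtration d \<Longrightarrow> d \<le> d' \<Longrightarrow> v \<in> filtration d'"
  by (auto simp: filtration_def intro: deg_less_mono)

lemma fil_0: "filtration 0 = {0}"
  by (auto simp: filtration_def deg_less_zero_iff)

lemma cr_fil: "v \<in> filtration d \<Longrightarrow> creation_op x v \<in> filtration (Suc d)"
  by (auto simp: filtration_def deg_less_X_mult simp flip: \<Phi>_X_mult)

lemma annihilate_fil:
  assumes "v \<in> filtration d"
  shows "prd (int j) (\<alpha> i) v \<in> filtration (d - 1)"
proof -
  obtain P where P: "v = \<Phi> P" "deg_less d P" using assms by (auto simp: filtration_def)
  show ?thesis
  proof (cases j)
    case 0
    then show ?thesis using P subspace_0[OF subspace_fil] by (simp add: annihilate_0_\<Phi>)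
  next
    case (Suc l)
    have "\<Phi> (pd (i, l) P) \<in> filtration (d - 1)" using P deg_less_pd[of d P] by (auto simp: filtration_def)
    then show ?thesis
      unfolding P(1) Suc annihilate_\<Phi> by (rule subspace_scale[OF subspace_fil])
  qed
qed

lemma create_fil: "v \<in> filtration d \<Longrightarrow> prd (- int (Suc l)) (\<alpha> i) v \<in> filtration (Suc d)"
  using cr_fil[of v d "(i, l)"] by (simp add: creation_op_def)

text \<open>The \<open>(-1)\<close>st product is the product of polynomials up to contractions, and each contraction lowers
  the degree by two.\<close>

lemma monomial_product_fil:
  assumes "deg_less b Q"
  shows "prd k (\<Phi> (mon m 1)) (\<Phi> Q) \<in> filtration (size m + b)"
    and "k \<ge> 0 \<Longrightarrow> prd k (\<Phi> (mon m 1)) (\<Phi> Q) \<in> filtration (size m + b - 1)"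
    and "prd (- 1) (\<Phi> (mon m 1)) (\<Phi> Q) - \<Phi> (mon m 1 * Q) \<in> filtration (size m + b - 1)"
proof -
  \<comment> \<open>The claims are proved together: for the third, the terms with
    \<open>j \<ge> 1\<close> involve nonnegative modes of the shorter monomial, as in the second.
    \<open>b\<close> is arbitrary since annihilating modes lower it.\<close>
  have "(\<forall>k. prd k (\<Phi> (mon m 1)) v \<in> filtration (size m + b)) \<and>
      (\<forall>k\<ge>0. prd k (\<Phi> (mon m 1)) v \<in> filtration (size m + b - 1)) \<and>
      (\<forall>Q. v = \<Phi> Q \<longrightarrow> prd (- 1) (\<Phi> (mon m 1)) v - \<Phi> (mon m 1 * Q) \<in> filtration (size m + b - 1))"
    if "v \<in> filtration b" for v b
    using that
  proof (induction m arbitrary: v b)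
    case empty
    have "\<Phi> (mon {#} 1) = vac" by (simp add: \<Phi>_monom fock_monomial_simps del: single_one)
    then show ?case
      using empty subspace_0[OF subspace_fil] by (auto simp: vacuum)
  next
    case (add x m)
    obtain i l where x: "x = (i, l)" by (cases x)
    let ?M = "\<Phi> (mon m 1)" and ?s = "size m"
    have M': "\<Phi> (mon (add_mset x m) 1) = prd (- int (Suc l)) (\<alpha> i) ?M"
      unfolding monom_add_mset[of x m] \<Phi>_X_mult by (simp add: creation_op_def x)
    show ?case
    \<comment> \<open>The truncated \<open>b - 1\<close> lowers the bound only for positive
      \<open>b\<close>.\<close>
    proof (cases "b = 0")
      case True
      then have "v = 0" using add.prems by (simp add: fil_0)
      moreover have "\<Phi> Q = 0 \<longleftrightarrow> Q = 0" for Q using \<Phi>_eq_0[of Q] by auto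
      ultimately show ?thesis using subspace_0[OF subspace_fil] by auto
    next
      case False
      then have b: "Suc (?s + b - 1) = ?s + b" "size (add_mset x m) + b - 1 = ?s + b"
        "Suc (?s + b) = size (add_mset x m) + b" by auto
      let ?A = "\<lambda>k j. prd (- int (Suc l + j)) (\<alpha> i) (prd (k + int j) ?M v)"
      let ?B = "\<lambda>k j. prd (k - int (Suc l + j)) ?M (prd (int j) (\<alpha> i) v)"
      have expand: "\<exists>N>0. prd k (\<Phi> (mon (add_mset x m) 1)) v =
          (\<Sum>j<N. scale (of_nat ((Suc l + j - 1) choose j)) (?A k j - scale ((- 1) ^ Suc l) (?B k j)))" for k
        using eventually_happens[OF eventually_conj[OF eventually_gt_at_top[of "0::nat"] iterate_minus[of "Suc l" k "\<alpha> i" ?M v]]]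
        unfolding M' by auto
      have B: "?B k j \<in> filtration (?s + b)" for k j
      proof -
        have "?B k j \<in> filtration (?s + (b - 1))"
          using add.IH[OF annihilate_fil[OF add.prems]] by blast
        then show ?thesis by (rule fil_mono) simp
      qed
      have A: "?A k j \<in> filtration (Suc (?s + b))" for k j
        using create_fil[of _ "?s + b" "l + j" i] add.IH[OF add.prems] by (simp add: add.commute)
      have A0: "?A k j \<in> filtration (?s + b)" if "k + int j \<ge> 0" for k j
      proof -
        have "prd (k + int j) ?M v \<in> filtration (?s + b - 1)" using add.IH[OF add.prems] that by blast
        from create_fil[OF this, of "l + j" i] show ?thesis unfolding b by simp
      qed
      have "prd k (\<Phi> (mon (add_mset x m) 1)) v \<in> filtration (size (add_mset x m) + b)" for k
      proof -
        obtain N where N: "prd k (\<Phi> (mon (add_mset x m) 1)) v =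
          (\<Sum>j<N. scale (of_nat ((Suc l + j - 1) choose j)) (?A k j - scale ((- 1) ^ Suc l) (?B k j)))"
          using expand by blast
        have "?B k j \<in> filtration (Suc (?s + b))" for j using B by (rule fil_mono) simp
        then show ?thesis unfolding N b(3)[symmetric]
          using A by (intro subspace_sum subspace_scale subspace_diff subspace_fil) auto
      qed
      moreover have "prd k (\<Phi> (mon (add_mset x m) 1)) v \<in> filtration (?s + b)" if "k \<ge> 0" for k
      proof -
        obtain N where N: "prd k (\<Phi> (mon (add_mset x m) 1)) v =
          (\<Sum>j<N. scale (of_nat ((Suc l + j - 1) choose j)) (?A k j - scale ((- 1) ^ Suc l) (?B k j)))"
          using expand by blast
        show ?thesis unfolding N
          using A0 B that by (intro subspace_sum subspace_scale subspace_diff subspace_fil) auto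
      qed
      moreover have "prd (- 1) (\<Phi> (mon (add_mset x m) 1)) v - \<Phi> (mon (add_mset x m) 1 * Q) \<in> filtration (?s + b)"
        if v: "v = \<Phi> Q" for Q
      proof -
        obtain N where N: "0 < N" "prd (- 1) (\<Phi> (mon (add_mset x m) 1)) v =
          (\<Sum>j<N. scale (of_nat ((Suc l + j - 1) choose j)) (?A (- 1) j - scale ((- 1) ^ Suc l) (?B (- 1) j)))"
          using expand by blast
        let ?f = "\<lambda>j. scale (of_nat ((Suc l + j - 1) choose j)) (?A (- 1) j - scale ((- 1) ^ Suc l) (?B (- 1) j))"
        let ?P = "\<Phi> (mon (add_mset x m) 1 * Q)"
        \<comment> \<open>The polynomial product is charged to the term \<open>j = 0\<close>, where
          the creation operator acts on the product for the shorter monomial; all other terms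
          satisfy the bound by themselves.\<close>
        have "?P = (\<Sum>j<N. if j = 0 then ?P else 0)" using N(1) by simp
        then have "prd (- 1) (\<Phi> (mon (add_mset x m) 1)) v - ?P = (\<Sum>j<N. ?f j - (if j = 0 then ?P else 0))"
          unfolding N(2) by (simp only: sum_subtractf)
        moreover have "?f j - (if j = 0 then ?P else 0) \<in> filtration (?s + b)" for j
        proof (cases "j = 0")
          case True
          have "prd (- 1) ?M v - \<Phi> (mon m 1 * Q) \<in> filtration (?s + b - 1)"
            using add.IH[OF add.prems] v by blast
          from cr_fil[OF this, of x]
          have "creation_op x (prd (- 1) ?M v) - ?P \<in> filtration (?s + b)"
            unfolding b monom_add_mset[of x m] mult.assoc \<Phi>_X_mult by (simp add: creation_op_def prd_diff)
          moreover have "creation_op x (prd (- 1) ?M v) = ?A (- 1) 0" by (simp add: creation_op_def x)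
          ultimately have "?A (- 1) 0 - ?P \<in> filtration (?s + b)" by simp
          then have "(?A (- 1) 0 - ?P) - scale ((- 1) ^ Suc l) (?B (- 1) 0) \<in> filtration (?s + b)"
            by (rule subspace_diff[OF subspace_fil _ subspace_scale[OF subspace_fil B]])
          moreover have "?f j - (if j = 0 then ?P else 0) = (?A (- 1) 0 - ?P) - scale ((- 1) ^ Suc l) (?B (- 1) 0)"
            by (simp add: True)
          ultimately show ?thesis by (simp only:)
        next
          case False
          then show ?thesis
            using A0[of "- 1" j] B[of "- 1" j]
            by (simp only: if_False diff_zero) (intro subspace_scale subspace_diff subspace_fil, auto)
        qed
        ultimately show ?thesis by (simp only:) (intro subspace_sum subspace_fil)
      qed
      ultimately show ?thesis unfolding b by blast
    qed
  qed
  from this[of "\<Phi> Q" b] assms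
  show "prd k (\<Phi> (mon m 1)) (\<Phi> Q) \<in> filtration (size m + b)"
    "k \<ge> 0 \<Longrightarrow> prd k (\<Phi> (mon m 1)) (\<Phi> Q) \<in> filtration (size m + b - 1)"
    "prd (- 1) (\<Phi> (mon m 1)) (\<Phi> Q) - \<Phi> (mon m 1 * Q) \<in> filtration (size m + b - 1)"
    by (auto simp: filtration_def)
qed

lemma product_fil:
  assumes "homogeneous a P" "deg_less b Q"
  shows "prd (- 1) (\<Phi> P) (\<Phi> Q) - \<Phi> (P * Q) \<in> filtration (a + b - 1)"
proof -
  let ?t = "\<lambda>m. prd (- 1) (\<Phi> (mon m 1)) (\<Phi> Q) - \<Phi> (mon m 1 * Q)"
  have P: "P = (\<Sum>m\<in>supp P. cmul (coef P m) (mon m 1))"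
    by (subst mpoly_sum_monom) (simp add: cmul_monom)
  have "prd (- 1) (\<Phi> P) (\<Phi> Q) = (\<Sum>m\<in>supp P. scale (coef P m) (prd (- 1) (\<Phi> (mon m 1)) (\<Phi> Q)))"
    using arg_cong[OF P, of "\<lambda>P. prd (- 1) (\<Phi> P) (\<Phi> Q)"]
    by (simp only: \<Phi>_sum \<Phi>_cmul prd_sum prd_simps)
  moreover have "\<Phi> (P * Q) = (\<Sum>m\<in>supp P. scale (coef P m) (\<Phi> (mon m 1 * Q)))"
    using arg_cong[OF P, of "\<lambda>P. \<Phi> (P * Q)"]
    by (simp only: \<Phi>_sum \<Phi>_cmul sum_distrib_right cmul_mult_left)
  ultimately have "prd (- 1) (\<Phi> P) (\<Phi> Q) - \<Phi> (P * Q) = (\<Sum>m\<in>supp P. scale (coef P m) (?t m))"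
    by (simp add: scale_right_diff_distrib sum_subtractf)
  also have "\<dots> \<in> filtration (a + b - 1)"
  proof (intro subspace_sum subspace_scale subspace_fil)
    fix m assume "m \<in> supp P"
    then have "size m = a" using assms(1) by (simp add: homogeneous_def)
    then show "?t m \<in> filtration (a + b - 1)" using monomial_product_fil(3)[OF assms(2), of m] by simp
  qed
  finally show ?thesis .
qed

section \<open>The group action and its invariants\<close>

lemma action_\<Phi>:
  assumes \<rho>: "standard_action \<rho>" and g: "g \<in> orthogonal_group"
  shows "\<rho> g (\<Phi> P) = \<Phi> (act g P)"
proof -
  have aut: "automorphism (\<rho> g)" and gen: "\<And>i. \<rho> g (\<alpha> i) = (\<Sum>j\<in>UNIV. scale (g $ j $ i) (\<alpha> j))"
    using \<rho> g by (auto simp: standard_action_def)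
  have lin: "\<rho> g (v + w) = \<rho> g v + \<rho> g w" "\<rho> g (scale c v) = scale c (\<rho> g v)"
    and prd: "\<rho> g (prd k v w) = prd k (\<rho> g v) (\<rho> g w)" and vac: "\<rho> g vac = vac" for c v w k
    using aut by (auto simp: automorphism_def Vector_Spaces.linear_iff)
  show ?thesis
  proof (induction P rule: mpoly_induct)
    case (monom m c)
    have "\<rho> g (\<Phi> (mon m 1)) = \<Phi> (act g (mon m 1))"
    proof (induction m)
      case empty
      show ?case by (simp add: act_simps \<Phi>_monom fock_monomial_simps vac del: single_one)
    next
      case (add x m)
      obtain i k where x: "x = (i, k)" by (cases x)
      have "\<rho> g (\<Phi> (mon (add_mset x m) 1)) = prd (- int (k + 1)) (\<rho> g (\<alpha> i)) (\<rho> g (\<Phi> (mon m 1)))"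
        unfolding monom_add_mset[of x m] \<Phi>_X_mult by (simp add: creation_op_def x prd)
      also have "\<dots> = (\<Sum>j\<in>UNIV. scale (g $ j $ i) (creation_op (j, k) (\<Phi> (act g (mon m 1)))))"
        unfolding gen add by (simp add: prd_sum prd_simps creation_op_def)
      also have "\<dots> = \<Phi> (act g (mon (add_mset x m) 1))"
        unfolding x monom_add_mset[of "(i, k)" m] act_simps(3) act_X
        by (simp add: sum_distrib_right cmul_mult_left \<Phi>_sum \<Phi>_cmul \<Phi>_X_mult)
      finally show ?case .
    qed
    then show ?case
      by (subst (1 2) monom_eq_cmul) (simp only: \<Phi>_cmul act_simps lin)
  qed (simp add: \<Phi>_add act_simps lin)
qed

lemma subalgebra_invariants:
  assumes \<rho>: "standard_action \<rho>" and G: "G \<subseteq> orthogonal_group"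
  shows "subalgebra (invariants \<rho> G)"
proof -
  have aut: "automorphism (\<rho> g)" if "g \<in> G" for g
    using \<rho> G that by (auto simp: standard_action_def)
  have lin: "\<rho> g (v + w) = \<rho> g v + \<rho> g w" "\<rho> g (scale c v) = scale c (\<rho> g v)"
    and prd: "\<rho> g (prd k v w) = prd k (\<rho> g v) (\<rho> g w)" and vac: "\<rho> g vac = vac" if "g \<in> G" for g c v w k
    using aut[OF that] by (auto simp: automorphism_def Vector_Spaces.linear_iff)
  have "\<rho> g 0 = 0" if "g \<in> G" for g using lin(2)[OF that, of 0 0] by simp
  then show ?thesis
    by (auto simp: subalgebra_def invariants_def subspace_def lin prd vac)
qed

text \<open>Summing over \<open>i\<close> the products of two entries of column \<open>i\<close>
  gives an entry of \<open>g ** transpose g\<close>, a Kronecker delta, which reduces the double sum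
  to its diagonal.\<close>

lemma \<omega>_invariant:
  assumes \<rho>: "standard_action \<rho>" and G: "G \<subseteq> orthogonal_group"
  shows "\<omega> p 1 \<in> invariants \<rho> G"
proof -
  have "\<rho> g (\<omega> p 1) = \<omega> p 1" if "g \<in> G" for g
  proof -
    have g: "g \<in> orthogonal_group" using that G by auto
    have aut: "automorphism (\<rho> g)" and gen: "\<And>i. \<rho> g (\<alpha> i) = (\<Sum>j\<in>UNIV. scale (g $ j $ i) (\<alpha> j))"
      using \<rho> g by (auto simp: standard_action_def)
    have prd: "\<rho> g (prd k v w) = prd k (\<rho> g v) (\<rho> g w)" for k v w
      using aut by (auto simp: automorphism_def)
    have add: "\<rho> g (v + w) = \<rho> g v + \<rho> g w" and zero: "\<rho> g 0 = 0" for v w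
      using aut by (auto simp: automorphism_def Vector_Spaces.linear_iff) (metis scale_zero_left)
    have sum: "\<rho> g (sum f A) = (\<Sum>a\<in>A. \<rho> g (f a))" for f :: "'n \<Rightarrow> 'v" and A
      by (induction A rule: infinite_finite_induct) (auto simp: add zero)
    have "g ** transpose g = Finite_Cartesian_Product.mat 1"
      using g by (simp add: orthogonal_group_def orthogonal_matrix_def)
    then have "(g ** transpose g) $ j $ l = Finite_Cartesian_Product.mat 1 $ j $ l" for j l by simp
    then have orth: "(\<Sum>i\<in>UNIV. g $ j $ i * g $ l $ i) = (if j = l then 1 else 0)" for j l
      by (simp add: matrix_matrix_mult_def transpose_def Finite_Cartesian_Product.mat_def)
    let ?p = "\<lambda>j l. prd (- int p) (\<alpha> j) (\<alpha> l)"
    have "\<rho> g (\<omega> p 1) = (\<Sum>i\<in>UNIV. \<Sum>l\<in>UNIV. \<Sum>j\<in>UNIV. scale (g $ l $ i * g $ j $ i) (?p j l))"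
      unfolding \<omega>_1 by (simp add: sum prd gen prd_sum prd_simps scale_sum_right)
    also have "\<dots> = (\<Sum>l\<in>UNIV. \<Sum>i\<in>UNIV. \<Sum>j\<in>UNIV. scale (g $ l $ i * g $ j $ i) (?p j l))"
      by (rule sum.swap)
    also have "\<dots> = (\<Sum>l\<in>UNIV. \<Sum>j\<in>UNIV. \<Sum>i\<in>UNIV. scale (g $ l $ i * g $ j $ i) (?p j l))"
      by (intro sum.cong refl sum.swap)
    also have "\<dots> = (\<Sum>l\<in>UNIV. \<Sum>j\<in>UNIV. scale (if l = j then 1 else 0) (?p j l))"
      by (simp add: orth flip: scale_sum_left)
    also have "\<dots> = (\<Sum>l\<in>UNIV. \<Sum>j\<in>UNIV. if j = l then ?p j l else 0)"
      by (intro sum.cong refl) auto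
    also have "\<dots> = \<omega> p 1" unfolding \<omega>_1 by simp
    finally show ?thesis .
  qed
  then show ?thesis by (simp add: invariants_def)
qed

section \<open>Finite generation by induction on the degree\<close>

theorem invariants_finitely_generated:
  assumes \<rho>: "standard_action \<rho>" and red: "reductive_group G" and G: "G \<subseteq> orthogonal_group"
  shows "finitely_generated (invariants \<rho> G)"
proof -
  define Inv where "Inv = {P. \<forall>g\<in>G. act g P = P}"
  have Inv_iff: "\<Phi> P \<in> invariants \<rho> G \<longleftrightarrow> P \<in> Inv" for P
  proof -
    have "\<rho> g (\<Phi> P) = \<Phi> (act g P)" if "g \<in> G" for g
      using action_\<Phi>[OF \<rho>] G that by blast
    then show ?thesis by (auto simp: invariants_def Inv_def \<Phi>_inject)
  qed
  note H = subalgebra_invariants[OF \<rho> G]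
  have H_\<omega>: "\<omega> 1 1 \<in> invariants \<rho> G" "\<omega> 3 1 \<in> invariants \<rho> G"
    using \<omega>_invariant[OF \<rho> G] by auto
  obtain e :: "'n \<Rightarrow> nat" where e: "bij_betw e UNIV {..<CARD('n)}"
    using ex_bij_betw_finite_nat[of "UNIV :: 'n set"] by (auto simp: atLeast0LessThan)
  from hilbert_invariants[OF red, of "CARD('n)", folded Inv_def]
  obtain T dg where T: "finite T" "\<forall>t\<in>T. t \<in> Inv \<and> homogeneous (dg t) t \<and> 1 \<le> dg t"
    and hilbert: "\<forall>P d. P \<in> Inv \<longrightarrow> homogeneous d P \<longrightarrow> 1 \<le> d \<longrightarrow> vars_in (UNIV \<times> {..<CARD('n)}) P \<longrightarrow>
      (\<exists>h. P = (\<Sum>t\<in>T. h t * t) \<and> (\<forall>t\<in>T. h t \<in> Inv \<and> (h t = 0 \<or> (\<exists>k. k + dg t = d \<and> homogeneous k (h t)))))"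
    by (elim exE conjE) (rule that)
  define S where "S = {\<omega> 1 1, \<omega> 3 1} \<union> \<Phi> ` T"
  define B where "B = span (words S)"
  have B: "subalgebra B" unfolding B_def by (rule subalgebra_span_words)
  then have B_sub: "subspace B" and B_vac: "vac \<in> B"
    and B_prd: "\<And>k a b. a \<in> B \<Longrightarrow> b \<in> B \<Longrightarrow> prd k a b \<in> B" by (auto simp: subalgebra_def)
  have "S \<subseteq> B" unfolding B_def by (auto intro: span_base words.letter)
  then have B_\<omega>: "\<omega> 1 1 \<in> B" "\<omega> 3 1 \<in> B" and B_T: "\<And>t. t \<in> T \<Longrightarrow> \<Phi> t \<in> B" by (auto simp: S_def)
  have S: "finite S" "S \<subseteq> invariants \<rho> G"
    using T H_\<omega> by (auto simp: S_def Inv_iff)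
  have "\<Phi> P \<in> B" if "P \<in> Inv" "deg_less d P" for P d
    using that
  proof (induction d arbitrary: P)
    case 0
    then show ?case using subspace_0[OF B_sub] by (simp add: deg_less_zero_iff)
  next
    case (Suc d)
    \<comment> \<open>Polarization keeps the degree, so Weyl's theorem can be applied to the
      invariants of degree at most \<open>d\<close> alone; the induction hypothesis is then used
      only for polynomials in the first copies.\<close>
    define F where "F = {P \<in> Inv. deg_less (Suc d) P}"
    have homog: "\<Phi> P \<in> B" if P: "P \<in> Inv" "homogeneous k P" "vars_in (UNIV \<times> {..<CARD('n)}) P" "k \<le> d" for P k
    proof (cases "k = 0")
      case True
      have "P = mon {#} (coef P {#})"
        using P(2) True by (intro poly_mapping_eqI) (auto simp: homogeneous_def lookup_single when_def in_keys_iff)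
      then have "\<Phi> P = scale (coef P {#}) vac" by (metis \<Phi>_monom fock_monomial_simps(1))
      then show ?thesis using B_vac by (simp add: subspace_scale[OF B_sub])
    next
      case False
      then obtain h where h: "P = (\<Sum>t\<in>T. h t * t)"
        "\<And>t. t \<in> T \<Longrightarrow> h t \<in> Inv \<and> (h t = 0 \<or> (\<exists>l. l + dg t = k \<and> homogeneous l (h t)))"
        using hilbert[rule_format, OF P(1,2) _ P(3)] by auto
      have "\<Phi> (h t * t) \<in> B" if t: "t \<in> T" for t
      proof (cases "h t = 0")
        case True
        then show ?thesis using subspace_0[OF B_sub] by simp
      next
        case False
        then obtain l where l: "l + dg t = k" "homogeneous l (h t)" using h(2)[OF t] by blast
        have "deg_less (Suc l) (h t)" using l(2) by (rule hom_deg_less)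
        \<comment> \<open>The generators have degree at least 1, so \<open>h t\<close> has degree
          below \<open>k \<le> d\<close>.\<close>
        then have "deg_less d (h t)" using l(1) T(2)[rule_format, OF t] P(4) by (auto elim!: deg_less_mono)
        then have "\<Phi> (h t) \<in> B" using h(2)[OF t] by (intro Suc.IH) auto
        then have pB: "prd (- 1) (\<Phi> (h t)) (\<Phi> t) \<in> B" using B_T[OF t] by (rule B_prd)
        have "deg_less (Suc (dg t)) t" using T(2)[rule_format, OF t] hom_deg_less by blast
        then have "prd (- 1) (\<Phi> (h t)) (\<Phi> t) - \<Phi> (h t * t) \<in> filtration (l + Suc (dg t) - 1)"
          by (rule product_fil[OF l(2)])
        then obtain R where R: "prd (- 1) (\<Phi> (h t)) (\<Phi> t) - \<Phi> (h t * t) = \<Phi> R" "deg_less k R"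
          using l(1) by (auto simp: filtration_def)
        have "h t * t \<in> Inv" using h(2)[OF t] T(2)[rule_format, OF t] by (auto simp: Inv_def act_simps)
        \<comment> \<open>The error term is a difference of two invariants and of degree below
          \<open>k\<close>, so the induction hypothesis covers it too.\<close>
        then have "\<Phi> R \<in> invariants \<rho> G"
          unfolding R(1)[symmetric] using H h(2)[OF t] T(2)[rule_format, OF t]
          by (intro subspace_diff) (auto simp: subalgebra_def Inv_iff)
        then have "R \<in> Inv" by (simp add: Inv_iff)
        moreover have "deg_less d R" using R(2) P(4) by (rule deg_less_mono)
        ultimately have "\<Phi> R \<in> B" by (rule Suc.IH)
        with pB have "prd (- 1) (\<Phi> (h t)) (\<Phi> t) - \<Phi> R \<in> B" by (rule subspace_diff[OF B_sub])
        then show ?thesis unfolding R(1)[symmetric] by simp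
      qed
      then show ?thesis unfolding h(1) \<Phi>_sum by (intro subspace_sum[OF B_sub])
    qed
    have "P \<in> {P. \<Phi> P \<in> B}"
    proof (rule polarization_from_few_copies[OF e, where F = F])
      show "mp.subspace F"
        unfolding F_def Inv_def mp.subspace_def
        by (auto simp: act_simps deg_less_add deg_less_cmul)
      show "polarize p q f \<in> F" if "f \<in> F" for p q f
      proof -
        have "\<Phi> f \<in> invariants \<rho> G" using that by (simp add: F_def Inv_iff)
        then have "\<Phi> (polarize p q f) \<in> invariants \<rho> G" by (rule pol_in_subalgebra[OF H H_\<omega>])
        then show ?thesis using that deg_less_pol by (auto simp: F_def Inv_iff)
      qed
      show "mp.subspace {P. \<Phi> P \<in> B}"
        unfolding mp.subspace_def
        using B_sub by (auto simp: \<Phi>_add \<Phi>_cmul subspace_0 subspace_add subspace_scale)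
      show "polarize p q f \<in> {P. \<Phi> P \<in> B}" if "f \<in> {P. \<Phi> P \<in> B}" for p q f
        using that pol_in_subalgebra[OF B B_\<omega>] by simp
      show "P \<in> F" using Suc.prems by (simp add: F_def)
      show "f \<in> {P. \<Phi> P \<in> B}" if f: "f \<in> F" "vars_in (UNIV \<times> {..<CARD('n)}) f" for f
      proof -
        have "\<Phi> (hcomp k f) \<in> B" if "k < Suc d" for k
        proof (rule homog)
          show "hcomp k f \<in> Inv" using f(1) by (auto simp: F_def Inv_def simp flip: hcomp_act)
          show "homogeneous k (hcomp k f)" by (rule hom_hcomp)
          show "vars_in (UNIV \<times> {..<CARD('n)}) (hcomp k f)"
            using f(2) supp_hcomp unfolding vars_in_def by blast
        qed (use that in simp)
        then have "\<Phi> (\<Sum>k<Suc d. hcomp k f) \<in> B"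
          unfolding \<Phi>_sum by (intro subspace_sum[OF B_sub]) auto
        then show ?thesis using f(1) by (simp add: F_def sum_hcomp del: sum.lessThan_Suc)
      qed
    qed
    then show ?case by simp
  qed
  moreover have "deg_less (Suc (Max (size ` supp P))) P" for P :: "('n \<times> nat) mpoly"
    by (auto simp: deg_less_def less_Suc_eq_le)
  ultimately have Inv_B: "\<Phi> P \<in> B" if "P \<in> Inv" for P using that by blast
  have "invariants \<rho> G \<subseteq> B"
  proof
    fix v assume v: "v \<in> invariants \<rho> G"
    obtain P where "v = \<Phi> P" using surj_\<Phi> by (metis surjD)
    then show "v \<in> B" using v Inv_iff Inv_B by simp
  qed
  moreover have "B \<subseteq> invariants \<rho> G"
    unfolding B_def using H S(2) by (rule span_words_minimal)
  ultimately have "invariants \<rho> G = span (words S)" by (simp add: B_def)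
  then show ?thesis unfolding finitely_generated_def using S by blast
qed

end

theorem theorem6p1:
  fixes scale :: "complex \<Rightarrow> 'v::ab_group_add \<Rightarrow> 'v"
    and vac :: 'v
    and prd :: "int \<Rightarrow> 'v \<Rightarrow> 'v \<Rightarrow> 'v"
    and \<alpha> :: "'n::finite \<Rightarrow> 'v"
    and \<rho> :: "complex ^ 'n ^ 'n \<Rightarrow> 'v \<Rightarrow> 'v"
    and G :: "(complex ^ 'n ^ 'n) set"
  assumes "heisenberg_vertex_algebra scale vac prd \<alpha>"
    and "heisenberg_vertex_algebra.standard_action scale vac prd \<alpha> \<rho>"
    and "reductive_group G"
    and "G \<subseteq> orthogonal_group"
  shows "vertex_algebra.finitely_generated scale vac prd (invariants \<rho> G)"
  using heisenberg_vertex_algebra.invariants_finitely_generated[OF assms] .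

end
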